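(* Let $\varphi\in C(\mathbb{R})$ be a time-limited kernel, let $r\in\mathbb{N}$ be such that $$\sum_{k=-\infty}^\infty(k-u)^j\varphi(u-k)=0,\qquad j=1,\dots,r-1,\ u\in\mathbb{R},$$ let $s\in\mathbb{N}$ with $s\le r$, and let $1\le p<\infty$. There are constants $K_1,C_1>0$, independent of $f$ and $W$, such that for every $f\in\Lambda^p$ and every $W>0$ $$\|f-S_W^\varphi(f)\|_p\le K_1\|\tilde f_{1/W,r}-f\|_{\ell_p(\Sigma_W)}+C_1\,\omega_s(f,1/W)_p.$$ In particular, $$\|f-S_W^\varphi(f)\|_p\le\max\{K_1,C_1\}\,\tilde\Omega_{r,s}\left(f,\tfrac1W,\Sigma_W\right)_p.$$
   Context: A function $\varphi\in C(\mathbb{R})$ is a time-limited kernel if there are $T_0<T_1$ in $\mathbb{R}$ with $\varphi(t)=0$ for $t\notin[T_0,T_1]$, and $\sum_{k=-\infty}^\infty\varphi(u-k)=1$ for all $u\in\mathbb{R}$. The generalized sampling operators are $(S_W^\varphi f)(t)=\sum_{k=-\infty}^\infty f\big(\frac kW\big)\varphi(Wt-k)$, $W>0$. Conventions: $\mathbb{N}=\{1,2,\dots\}$; functions are defined pointwise (functions equal almost everywhere are not identified); $\|\cdot\|_p$ is the $L^p(\mathbb{R})$ norm. $M(\mathbb{R})$ is the set of bounded measurable functions on $\mathbb{R}$. A sequence $\Sigma=(x_j)_{j\in\mathbb{Z}}\subset\mathbb{R}$ is admissible if $0<\inf_j(x_j-x_{j-1})\le\sup_j(x_j-x_{j-1})<\infty$;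 put $\|f\|_{\ell_p(\Sigma)}=\big(\sum_{j\in\mathbb{Z}}|f(x_j)|^p(x_j-x_{j-1})\big)^{1/p}$. $\Lambda^p=\{f\in M(\mathbb{R}):\|f\|_{\ell_p(\Sigma)}<\infty\text{ for every admissible }\Sigma\}\subset L^p(\mathbb{R})$. $\Sigma_W=(j/W)_{j\in\mathbb{Z}}$, so $\|f\|_{\ell_p(\Sigma_W)}=\big(\frac1W\sum_{j\in\mathbb{Z}}|f(j/W)|^p\big)^{1/p}$. Modulus of smoothness: $\Delta_h^s f(x)=\sum_{k=0}^s\binom sk(-1)^{s-k}f(x+kh)$, $\omega_s(f,\delta)_p=\sup_{0<h\le\delta}\|\Delta_h^sf\|_p$. Steklov averages ($\delta>0$): $\tilde f_{\delta,r}(x)=(-\delta)^{-r}\int_0^\delta\cdots\int_0^\delta\sum_{m=1}^r(-1)^{r-m+1}\binom rm f\big(x+\frac mr(t_1+\dots+t_r)\big)\,dt_1\cdots dt_r$. Semi-discrete modulus: $\tilde\Omega_{r,s}(f,\frac1W,\Sigma_W)_p=\|\tilde f_{1/W,r}-f\|_{\ell_p(\Sigma_W)}+\omega_s(f,1/W)_p$. *)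

theory Defs
  imports "HOL-Analysis.Analysis"
begin

text \<open>
  Functions take values in a type of the sorts \<open>real_normed_field\<close> and \<open>banach\<close>, so that the
  real-valued and the complex-valued theory are both covered. All norms and moduli are
  \<open>ennreal\<close>-valued, so that \<open>\<infinity>\<close> is the value of a divergent sum, integral or supremum.
\<close>

definition ennroot :: "real \<Rightarrow> ennreal \<Rightarrow> ennreal" where
  "ennroot p a = (if a = \<infinity> then \<infinity> else ennreal (enn2real a powr (1 / p)))"

definition Lp_norm :: "real \<Rightarrow> (real \<Rightarrow> 'a::real_normed_vector) \<Rightarrow> ennreal" where
  "Lp_norm p f = ennroot p (\<integral>\<^sup>+ t. ennreal (norm (f t) powr p) \<partial>lebesgue)"


subsection \<open>Generalized sampling operators\<close>

definition time_limited_kernel :: "(real \<Rightarrow> 'a::real_normed_field) \<Rightarrow> bool" where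
  "time_limited_kernel \<phi> \<longleftrightarrow>
     continuous_on UNIV \<phi> \<and>
     (\<exists>T0 T1. T0 < T1 \<and> (\<forall>t. t \<notin> {T0..T1} \<longrightarrow> \<phi> t = 0)) \<and>
     (\<forall>u. ((\<lambda>k::int. \<phi> (u - of_int k)) has_sum 1) UNIV)"

definition sampling_op ::
    "(real \<Rightarrow> 'a::real_normed_field) \<Rightarrow> real \<Rightarrow> (real \<Rightarrow> 'a) \<Rightarrow> real \<Rightarrow> 'a" where
  "sampling_op \<phi> W f t = (\<Sum>\<^sub>\<infinity>k::int. f (of_int k / W) * \<phi> (W * t - of_int k))"


subsection \<open>Discrete norms and the spaces \<open>\<Lambda>\<^sup>p\<close>\<close>

text \<open>The infimum and supremum are taken in \<open>ereal\<close>, as the gaps may be unbounded.\<close>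

definition admissible :: "(int \<Rightarrow> real) \<Rightarrow> bool" where
  "admissible x \<longleftrightarrow>
     0 < (INF j. ereal (x j - x (j - 1))) \<and> (SUP j. ereal (x j - x (j - 1))) < \<infinity>"

definition lp_norm ::
    "real \<Rightarrow> (int \<Rightarrow> real) \<Rightarrow> (real \<Rightarrow> 'a::real_normed_vector) \<Rightarrow> ennreal" where
  "lp_norm p x f =
     ennroot p (\<Sum>\<^sub>\<infinity>j::int. ennreal (norm (f (x j)) powr p * (x j - x (j - 1))))"

definition Lambda_space :: "real \<Rightarrow> (real \<Rightarrow> 'a::real_normed_vector) set" where
  "Lambda_space p =
     {f. f \<in> borel_measurable lebesgue \<and> bounded (range f) \<and>
         (\<forall>x. admissible x \<longrightarrow> lp_norm p x f < \<infinity>)}"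

definition uniform_seq :: "real \<Rightarrow> int \<Rightarrow> real" where
  "uniform_seq W j = of_int j / W"


subsection \<open>Moduli of smoothness and Steklov averages\<close>

definition fwd_diff :: "nat \<Rightarrow> real \<Rightarrow> (real \<Rightarrow> 'a::real_normed_field) \<Rightarrow> real \<Rightarrow> 'a" where
  "fwd_diff s h f x =
     (\<Sum>k=0..s. of_nat (s choose k) * (- 1) ^ (s - k) * f (x + of_nat k * h))"

definition smoothness_modulus ::
    "nat \<Rightarrow> (real \<Rightarrow> 'a::real_normed_field) \<Rightarrow> real \<Rightarrow> real \<Rightarrow> ennreal" where
  "smoothness_modulus s f \<delta> p = (SUP h\<in>{0<..\<delta>}. Lp_norm p (fwd_diff s h f))"

text \<open>
  \<open>iter_integral \<delta> n F\<close> is the \<open>n\<close>-fold iterated integral of \<open>F [t\<^sub>1, \<dots>, t\<^sub>n]\<close> over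
  \<open>[0, \<delta>]\<^sup>n\<close>. It is iterated, rather than taken with respect to a product measure, because
  \<open>(t\<^sub>1, \<dots>, t\<^sub>n) \<mapsto> f (t\<^sub>1 + \<dots> + t\<^sub>n)\<close> need not be measurable for the product
  \<open>\<sigma>\<close>-algebra if \<open>f\<close> is only Lebesgue measurable.
\<close>

primrec iter_integral ::
    "real \<Rightarrow> nat \<Rightarrow> (real list \<Rightarrow> 'a) \<Rightarrow> 'a::{banach, second_countable_topology}" where
  "iter_integral \<delta> 0 F = F []"
| "iter_integral \<delta> (Suc n) F =
     (LINT t:{0..\<delta>}|lebesgue. iter_integral \<delta> n (\<lambda>ts. F (t # ts)))"

definition steklov ::
    "real \<Rightarrow> nat \<Rightarrow> (real \<Rightarrow> 'a::{real_normed_field, banach, second_countable_topology})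
      \<Rightarrow> real \<Rightarrow> 'a" where
  "steklov \<delta> r f x =
     ((- \<delta>) powi (- int r)) *\<^sub>R
       iter_integral \<delta> r (\<lambda>ts. \<Sum>m=1..r. (- 1) ^ (r - m + 1) * of_nat (r choose m)
                                  * f (x + of_nat m / of_nat r * sum_list ts))"

definition semidiscrete_modulus ::
    "nat \<Rightarrow> nat \<Rightarrow> (real \<Rightarrow> 'a::{real_normed_field, banach, second_countable_topology})
      \<Rightarrow> real \<Rightarrow> (int \<Rightarrow> real) \<Rightarrow> real \<Rightarrow> ennreal" where
  "semidiscrete_modulus r s f \<delta> x p =
     lp_norm p x (\<lambda>t. steklov \<delta> r f t - f t) + smoothness_modulus s f \<delta> p"

end

theory Submission
  imports Defs
begin

text \<open>
  Put \<open>\<delta> = 1 / W\<close>, let \<open>g\<close> be the Steklov average of \<open>f\<close> of order \<open>r\<close> and step \<open>\<delta>\<close>, and write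
  \<open>S\<close> for the sampling operator. As \<open>S\<close> is linear,
  \<open>f - S f = (f - g) + (g - S g) + S (g - f)\<close>, and each summand has its own reason to be small.

  \<^item> \<open>g - f\<close> is, up to sign, the mean of the differences \<open>\<Delta>\<^sub>h\<^sup>r f\<close> with
    \<open>h = (t\<^sub>1 + \<dots> + t\<^sub>r) / r\<close> in \<open>[0, \<delta>]\<close>. Minkowski's integral inequality bounds its
    norm by that of \<open>\<Delta>\<^sub>h\<^sup>r f\<close>, which is at most \<open>2\<^sup>r\<^sup>-\<^sup>s\<close> times the modulus of order \<open>s\<close>
    (\<open>Lp_norm_steklov_minus_le\<close>).

  \<^item> \<open>S (g - f)\<close> sees \<open>g - f\<close> at the nodes \<open>k / W\<close> only. Each point lies in the support of
    boundedly many summands and each summand lives on an interval of length proportional to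
    \<open>1 / W\<close>, so that \<open>S\<close> is bounded from the discrete norm to the \<open>L\<^sup>p\<close> norm
    (\<open>Lp_norm_sampling_op_le\<close>).

  \<^item> \<open>g - S g\<close> is small because \<open>g\<close> is smooth and \<open>S\<close> reproduces polynomials of degree less than
    \<open>r\<close>; that is what the moment conditions say.
    Here \<open>g\<close> is a combination of \<open>r\<close>-fold averages of dilates of \<open>f\<close>. Such an average
    has a Taylor expansion of order \<open>r\<close> whose remainder is controlled by an integral of
    \<open>\<Delta>\<^sub>h\<^sup>r f\<close> over a window of length proportional to \<open>\<delta>\<close>: each integration over
    \<open>[0, \<delta>]\<close> turns an increment into the integral of a first difference
    (\<open>window_integral_increment\<close>), and iterating this replaces \<open>r\<close> derivatives by the
    \<open>r\<close>-th difference without differentiating anything (\<open>window_integral_taylor\<close>). Minkowski's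
    integral inequality turns the pointwise bound into a norm bound
    (\<open>Lp_norm_steklov_sampling_error_le\<close>).

  Minkowski's integral inequality rests on Tonelli's theorem for functions such as
  \<open>(x, z) \<mapsto> f (x + z)\<close>, which need not be measurable for the product \<open>\<sigma>\<close>-algebra if \<open>f\<close> is only
  Lebesgue measurable. In the first and the third estimate \<open>f\<close> enters only through integrals, so it
  may be replaced there by a bounded Borel function that agrees with it almost everywhere; the second
  one depends on the values of \<open>f\<close> at the nodes and keeps \<open>f\<close> itself.
\<close>

section \<open>The \<open>L\<^sup>p\<close> norm and the inequalities of Minkowski\<close>

lemma ennroot_mono:
  assumes "0 < p" "a \<le> b"
  shows "ennroot p a \<le> ennroot p b"
proof (cases "b = \<infinity>")
  case False
  then have "a \<noteq> \<infinity>" using assms(2) by (auto simp: top_unique)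
  moreover have "enn2real a \<le> enn2real b"
    using False assms(2) by (intro enn2real_mono) (auto simp: less_top)
  ultimately show ?thesis
    using False assms(1) by (auto simp: ennroot_def intro!: ennreal_leI powr_mono2)
qed (simp add: ennroot_def)

lemma ennroot_powr:
  assumes "0 < p" "0 \<le> c"
  shows "ennroot p (ennreal (c powr p)) = ennreal c"
  using assms by (simp add: ennroot_def powr_powr)

lemma ennroot_cmult:
  assumes "0 < p" "0 \<le> c"
  shows "ennroot p (ennreal (c powr p) * a) = ennreal c * ennroot p a"
proof (cases a)
  case (real b)
  have "ennreal (c powr p) * a = ennreal (c powr p * b)"
    using real by (simp add: ennreal_mult)
  then show ?thesis
    using real assms by (simp add: ennroot_def powr_mult powr_powr flip: ennreal_mult)
next
  case top
  then show ?thesis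
    using assms by (auto simp: ennroot_def ennreal_mult_top)
qed

lemma Lp_norm_le_iff:
  assumes "0 < p" "0 \<le> B"
  shows "Lp_norm p f \<le> ennreal B \<longleftrightarrow>
    (\<integral>\<^sup>+ t. ennreal (norm (f t) powr p) \<partial>lebesgue) \<le> ennreal (B powr p)" (is "_ \<longleftrightarrow> ?N \<le> _")
proof
  assume "?N \<le> ennreal (B powr p)"
  then show "Lp_norm p f \<le> ennreal B"
    using ennroot_mono[OF assms(1)] ennroot_powr[OF assms] unfolding Lp_norm_def by metis
next
  assume L: "Lp_norm p f \<le> ennreal B"
  then have fin: "?N \<noteq> \<infinity>"
    by (auto simp: Lp_norm_def ennroot_def top_unique)
  then have "enn2real ?N powr (1/p) \<le> B"
    using L assms by (simp add: Lp_norm_def ennroot_def)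
  then have "(enn2real ?N powr (1/p)) powr p \<le> B powr p"
    using assms by (intro powr_mono2) auto
  then have "enn2real ?N \<le> B powr p"
    using assms by (simp add: powr_powr)
  then show "?N \<le> ennreal (B powr p)"
    using fin by (metis ennreal_enn2real ennreal_leI infinity_ennreal_def less_top)
qed

lemma Lp_norm_mono_AE:
  assumes "0 < p" "AE x in lebesgue. norm (f x) \<le> norm (g x)"
  shows "Lp_norm p f \<le> Lp_norm p g"
  unfolding Lp_norm_def using assms
  by (intro ennroot_mono nn_integral_mono_AE) (auto elim!: eventually_mono intro!: ennreal_leI powr_mono2)

lemma Lp_norm_cong_AE:
  assumes "AE x in lebesgue. f x = g x"
  shows "Lp_norm p f = Lp_norm p g"
  unfolding Lp_norm_def using assms
  by (intro arg_cong[where f = "ennroot p"] nn_integral_cong_AE) (auto elim!: eventually_mono)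

lemma Lp_norm_zero: "Lp_norm p (\<lambda>x. 0) = 0"
  by (simp add: Lp_norm_def ennroot_def)

lemma Lp_norm_bound_cmult:
  assumes "0 < p" "0 \<le> c" "f \<in> borel_measurable lebesgue"
    and "\<And>x. norm (g x) \<le> c * norm (f x)"
  shows "Lp_norm p g \<le> ennreal c * Lp_norm p f"
proof -
  have [measurable]: "f \<in> borel_measurable lebesgue" by fact
  have "(\<integral>\<^sup>+ t. ennreal (norm (g t) powr p) \<partial>lebesgue)
      \<le> (\<integral>\<^sup>+ t. ennreal (c powr p) * ennreal (norm (f t) powr p) \<partial>lebesgue)"
  proof (intro nn_integral_mono)
    fix x
    have "norm (g x) powr p \<le> (c * norm (f x)) powr p"
      using assms(1,4) by (intro powr_mono2) auto
    then show "ennreal (norm (g x) powr p) \<le> ennreal (c powr p) * ennreal (norm (f x) powr p)"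
      using assms(2) by (simp add: powr_mult ennreal_leI flip: ennreal_mult)
  qed
  also have "\<dots> = ennreal (c powr p) * (\<integral>\<^sup>+ t. ennreal (norm (f t) powr p) \<partial>lebesgue)"
    by (rule nn_integral_cmult) measurable
  finally show ?thesis
    unfolding Lp_norm_def using ennroot_mono[OF assms(1)] ennroot_cmult[OF assms(1,2)] by metis
qed

lemma Lp_norm_translate:
  assumes [measurable]: "f \<in> borel_measurable lebesgue"
  shows "Lp_norm p (\<lambda>x. f (x + h)) = Lp_norm p f"
  using nn_integral_real_affine_lebesgue[of "\<lambda>x. ennreal (norm (f x) powr p)" 1 h]
  by (simp add: Lp_norm_def add.commute)

text \<open>
  The endpoint \<open>0\<close> has to be added to the convexity on the open half-line: there \<open>0 powr p = 0\<close>,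
  and the inequality reads \<open>u\<^sup>p \<le> u\<close> for \<open>0 < u < 1\<close>.
\<close>

lemma powr_convex_nonneg:
  fixes p :: real
  assumes "1 \<le> p"
  shows "convex_on {0..} (\<lambda>x. x powr p)"
proof (intro convex_onI)
  fix t x y :: real
  assume t: "0 < t" "t < 1" and xy: "x \<in> {0..}" "y \<in> {0..}"
  have shrink: "(u * z) powr p \<le> u * z powr p" if "0 < u" "u < 1" "0 \<le> z" for u z
  proof -
    have "u powr p \<le> u powr 1"
      using that assms by (intro powr_mono') auto
    then show ?thesis using that by (simp add: powr_mult mult_right_mono)
  qed
  show "((1 - t) *\<^sub>R x + t *\<^sub>R y) powr p \<le> (1 - t) * x powr p + t * y powr p"
  proof (cases "x = 0 \<or> y = 0")
    case True
    then show ?thesis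
      using shrink[of t y] shrink[of "1 - t" x] t xy assms by auto
  next
    case False
    then show ?thesis
      using convex_onD[OF powr_convex[OF assms], of t x y] t xy by auto
  qed
qed auto

text \<open>
  With \<open>t = B / (A + B)\<close> the sum \<open>|f| + |g|\<close> is \<open>A + B\<close> times the convex combination of the
  normalised functions \<open>|f| / A\<close> and \<open>|g| / B\<close>, so that convexity of the \<open>p\<close>-th power, integrated,
  gives the claim. Positive upper bounds in place of the norms themselves avoid division by a
  vanishing norm.
\<close>

lemma Lp_norm_triangle_bounds:
  assumes p: "1 \<le> p" and meas: "f \<in> borel_measurable lebesgue" "g \<in> borel_measurable lebesgue"
    and AB: "0 < A" "0 < B" "Lp_norm p f \<le> ennreal A" "Lp_norm p g \<le> ennreal B"
  shows "Lp_norm p (\<lambda>x. f x + g x) \<le> ennreal (A + B)"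
proof -
  have [measurable]: "f \<in> borel_measurable lebesgue" "g \<in> borel_measurable lebesgue" by fact+
  let ?N = "\<lambda>f. \<integral>\<^sup>+ t. ennreal (norm (f t) powr p) \<partial>lebesgue"
  define a where "a = (A + B) powr (p - 1) * A powr (1 - p)"
  define b where "b = (A + B) powr (p - 1) * B powr (1 - p)"
  have ab: "0 \<le> a" "0 \<le> b" unfolding a_def b_def by auto
  have pt: "norm (f x + g x) powr p \<le> a * norm (f x) powr p + b * norm (g x) powr p" for x
  proof -
    define t where "t = B / (A + B)"
    have t: "0 \<le> t" "t \<le> 1" "1 - t = A / (A + B)" using AB by (auto simp: t_def field_simps)
    have "norm (f x + g x) powr p \<le> (norm (f x) + norm (g x)) powr p"
      using p by (intro powr_mono2 norm_triangle_ineq) auto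
    also have "norm (f x) + norm (g x)
        = (A + B) * ((1 - t) * (norm (f x) / A) + t * (norm (g x) / B))"
    proof -
      have "(A + B) * (A / (A + B) * (norm (f x) / A)) = norm (f x)"
        "(A + B) * (B / (A + B) * (norm (g x) / B)) = norm (g x)"
        using AB by auto
      then show ?thesis unfolding t(3) distrib_left by (simp add: t_def)
    qed
    also have "\<dots> powr p = (A + B) powr p * ((1 - t) * (norm (f x) / A) + t * (norm (g x) / B)) powr p"
      using AB t by (intro powr_mult)
    also have "\<dots> \<le> (A + B) powr p *
        ((1 - t) * (norm (f x) / A) powr p + t * (norm (g x) / B) powr p)"
      using convex_onD[OF powr_convex_nonneg[OF p], of t "norm (f x) / A" "norm (g x) / B"] AB t
      by (intro mult_left_mono) auto
    also have "\<dots> = a * norm (f x) powr p + b * norm (g x) powr p"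
      using AB unfolding a_def b_def t(3)
      by (simp add: t_def powr_divide powr_diff field_simps)
    finally show ?thesis .
  qed
  have "?N (\<lambda>x. f x + g x)
      \<le> (\<integral>\<^sup>+ t. ennreal a * ennreal (norm (f t) powr p) + ennreal b * ennreal (norm (g t) powr p) \<partial>lebesgue)"
    using ab pt by (intro nn_integral_mono) (simp add: ennreal_leI flip: ennreal_mult ennreal_plus)
  also have "\<dots> = ennreal a * ?N f + ennreal b * ?N g"
    by (simp add: nn_integral_add nn_integral_cmult)
  also have "\<dots> \<le> ennreal a * ennreal (A powr p) + ennreal b * ennreal (B powr p)"
    using AB p by (intro add_mono mult_left_mono) (auto simp flip: Lp_norm_le_iff)
  also have "\<dots> = ennreal (a * A powr p + b * B powr p)"
    using ab by (simp flip: ennreal_mult ennreal_plus)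
  also have "a * A powr p + b * B powr p = (A + B) powr p"
  proof -
    have "a * A powr p = (A + B) powr (p - 1) * A" "b * B powr p = (A + B) powr (p - 1) * B"
      using AB by (simp_all add: a_def b_def mult.assoc flip: powr_add)
    then have "a * A powr p + b * B powr p = (A + B) powr (p - 1) * (A + B)"
      by (simp add: distrib_left)
    then show ?thesis using AB by (simp add: powr_diff)
  qed
  finally show ?thesis
    using AB p by (subst Lp_norm_le_iff) auto
qed

lemma Lp_norm_triangle:
  assumes p: "1 \<le> p" and meas: "f \<in> borel_measurable lebesgue" "g \<in> borel_measurable lebesgue"
  shows "Lp_norm p (\<lambda>x. f x + g x) \<le> Lp_norm p f + Lp_norm p g"
proof (cases "Lp_norm p f = \<infinity> \<or> Lp_norm p g = \<infinity>")
  case False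
  then obtain a b where ab: "Lp_norm p f = ennreal a" "Lp_norm p g = ennreal b" "0 \<le> a" "0 \<le> b"
    by (metis ennreal_cases infinity_ennreal_def)
  show ?thesis
  proof (rule ennreal_le_epsilon)
    fix e :: real assume e: "0 < e"
    have "Lp_norm p (\<lambda>x. f x + g x) \<le> ennreal ((a + e/2) + (b + e/2))"
      using ab e by (intro Lp_norm_triangle_bounds[OF p meas]) (auto intro!: ennreal_leI)
    also have "\<dots> = Lp_norm p f + Lp_norm p g + ennreal e"
      using ab e by (simp flip: ennreal_plus)
    finally show "Lp_norm p (\<lambda>x. f x + g x) \<le> Lp_norm p f + Lp_norm p g + ennreal e" .
  qed
qed auto

lemma Lp_norm_sum:
  fixes f :: "'i \<Rightarrow> real \<Rightarrow> 'b::{real_normed_vector, second_countable_topology}"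
  assumes "1 \<le> p" "finite I" "\<And>i. i \<in> I \<Longrightarrow> f i \<in> borel_measurable lebesgue"
  shows "Lp_norm p (\<lambda>x. \<Sum>i\<in>I. f i x) \<le> (\<Sum>i\<in>I. Lp_norm p (f i))"
  using assms(2,3)
proof (induction I)
  case (insert i I)
  have "Lp_norm p (\<lambda>x. f i x + (\<Sum>i\<in>I. f i x)) \<le> Lp_norm p (f i) + Lp_norm p (\<lambda>x. \<Sum>i\<in>I. f i x)"
    using insert by (intro Lp_norm_triangle[OF assms(1)] borel_measurable_sum) auto
  also have "\<dots> \<le> Lp_norm p (f i) + (\<Sum>i\<in>I. Lp_norm p (f i))"
    using insert by (intro add_left_mono) auto
  finally show ?case using insert by simp
qed (simp add: Lp_norm_zero)

lemma set_integrable_interval_bounded: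
  fixes g :: "real \<Rightarrow> 'b::{banach, second_countable_topology}"
  assumes "g \<in> borel_measurable borel" "\<And>x. norm (g x) \<le> B"
  shows "set_integrable lborel {a..b} g"
  unfolding set_integrable_def using assms
  by (intro integrableI_bounded_set_indicator[where B = B]) (auto simp: emeasure_lborel_Icc_eq)

text \<open>
  Jensen's inequality for the \<open>p\<close>-th power on an interval: integrate the inequality that puts the
  graph of the power above its tangent at the mean value \<open>c\<close>.
\<close>

lemma powr_integral_le_integral_powr:
  fixes g :: "real \<Rightarrow> real"
  assumes p: "1 \<le> p" and ab: "a < b" and g: "g \<in> borel_measurable borel"
    and bd: "\<And>z. 0 \<le> g z" "\<And>z. g z \<le> B"
  shows "(LINT z:{a..b}|lborel. g z) powr p
    \<le> (b - a) powr (p - 1) * (LINT z:{a..b}|lborel. g z powr p)"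
proof -
  have [measurable]: "g \<in> borel_measurable borel" by fact
  define c where "c = (LINT z:{a..b}|lborel. g z) / (b - a)"
  have B: "0 \<le> B" using bd[of 0] by linarith
  have int: "set_integrable lborel {a..b} g" "set_integrable lborel {a..b} (\<lambda>z. g z powr p)"
    using p bd B
    by (auto intro!: set_integrable_interval_bounded[of g B]
        set_integrable_interval_bounded[of "\<lambda>z. g z powr p" "B powr p"] powr_mono2)
  have int_const: "set_integrable lborel {a..b} (\<lambda>z. d)"
      "(LINT z:{a..b}|lborel. d) = (b - a) * d" for d :: real
    using ab by (auto simp: set_integrable_interval_bounded[where B = "norm d"] set_integral_const)
  have int0: "0 \<le> (LINT z:{a..b}|lborel. g z)" "0 \<le> (LINT z:{a..b}|lborel. g z powr p)"
    unfolding set_lebesgue_integral_def using bd by (auto intro!: integral_nonneg_AE)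
  have "c powr p * (b - a) \<le> (LINT z:{a..b}|lborel. g z powr p)"
  proof (cases "c = 0")
    case False
    then have c: "0 < c" using int0 ab unfolding c_def by (auto simp: divide_simps)
    have "c powr p + p * c powr (p - 1) * (g z - c) \<le> g z powr p" for z
    proof -
      have "p * c powr (p - 1) * (g z - c) \<le> g z powr p - c powr p"
        using c bd
        by (intro convex_on_imp_above_tangent[OF powr_convex_nonneg[OF p]])
          (auto intro!: derivative_eq_intros)
      then show ?thesis by linarith
    qed
    then have "(LINT z:{a..b}|lborel. (c powr p - p * c powr (p - 1) * c) + p * c powr (p - 1) * g z)
        \<le> (LINT z:{a..b}|lborel. g z powr p)"
      using int int_const by (intro set_integral_mono set_integral_add) (auto simp: algebra_simps)
    also have "(LINT z:{a..b}|lborel. (c powr p - p * c powr (p - 1) * c) + p * c powr (p - 1) * g z)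
        = (b - a) * (c powr p - p * c powr (p - 1) * c)
          + p * c powr (p - 1) * (LINT z:{a..b}|lborel. g z)"
      using int int_const by (subst set_integral_add) auto
    also have "(LINT z:{a..b}|lborel. g z) = (b - a) * c"
      using ab by (simp add: c_def)
    finally show ?thesis by (simp add: algebra_simps)
  qed (use int0 in auto)
  then have "(b - a) powr (p - 1) * (c powr p * (b - a))
      \<le> (b - a) powr (p - 1) * (LINT z:{a..b}|lborel. g z powr p)"
    by (intro mult_left_mono) auto
  moreover have "(b - a) powr (p - 1) * (c powr p * (b - a)) = (LINT z:{a..b}|lborel. g z) powr p"
    using ab int0 by (simp add: c_def powr_divide powr_diff)
  ultimately show ?thesis by simp
qed

text \<open>
  Minkowski's integral inequality, with a common bound for the norms of the sections: Jensen's
  inequality for each \<open>x\<close>, followed by Tonelli's theorem.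
\<close>

lemma Lp_norm_integral_le:
  fixes \<Phi> :: "real \<Rightarrow> real \<Rightarrow> 'b::{banach, second_countable_topology}"
  assumes p: "1 \<le> p" and ab: "a < b"
    and meas: "(\<lambda>(x, z). \<Phi> x z) \<in> borel_measurable (borel \<Otimes>\<^sub>M borel)"
    and bd: "\<And>x z. norm (\<Phi> x z) \<le> M"
    and le: "\<And>z. z \<in> {a..b} \<Longrightarrow> Lp_norm p (\<lambda>x. \<Phi> x z) \<le> C"
  shows "Lp_norm p (\<lambda>x. LINT z:{a..b}|lborel. \<Phi> x z) \<le> ennreal (b - a) * C"
proof (cases C)
  case top
  then show ?thesis using ab by (simp add: ennreal_mult_top)
next
  case (real c)
  have [measurable]: "(\<lambda>(x, z). \<Phi> x z) \<in> borel_measurable (borel \<Otimes>\<^sub>M borel)" by fact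
  let ?I = "\<lambda>z. indicator {a..b} z :: ennreal"
  have pt: "ennreal (norm (LINT z:{a..b}|lborel. \<Phi> x z) powr p)
      \<le> ennreal ((b - a) powr (p - 1)) * (\<integral>\<^sup>+ z. ?I z * ennreal (norm (\<Phi> x z) powr p) \<partial>lborel)" for x
  proof -
    have [measurable]: "\<Phi> x \<in> borel_measurable borel" by measurable
    have "norm (LINT z:{a..b}|lborel. \<Phi> x z) \<le> (LINT z:{a..b}|lborel. norm (\<Phi> x z))"
      using set_integral_norm_bound[OF set_integrable_interval_bounded[of "\<Phi> x" M a b]] bd by simp
    then have "norm (LINT z:{a..b}|lborel. \<Phi> x z) powr p \<le> (LINT z:{a..b}|lborel. norm (\<Phi> x z)) powr p"
      using p by (intro powr_mono2) auto
    also have "\<dots> \<le> (b - a) powr (p - 1) * (LINT z:{a..b}|lborel. norm (\<Phi> x z) powr p)"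
      using bd by (intro powr_integral_le_integral_powr[OF p ab]) auto
    finally have "ennreal (norm (LINT z:{a..b}|lborel. \<Phi> x z) powr p)
        \<le> ennreal ((b - a) powr (p - 1)) * ennreal (LINT z:{a..b}|lborel. norm (\<Phi> x z) powr p)"
      by (simp add: ennreal_leI flip: ennreal_mult')
    also have "ennreal (LINT z:{a..b}|lborel. norm (\<Phi> x z) powr p)
        = (\<integral>\<^sup>+ z. ennreal (indicator {a..b} z *\<^sub>R (norm (\<Phi> x z) powr p)) \<partial>lborel)"
      unfolding set_lebesgue_integral_def using p bd
      by (intro nn_integral_eq_integral[symmetric]
          set_integrable_interval_bounded[unfolded set_integrable_def, where B = "M powr p"])
        (auto intro!: powr_mono2)
    also have "\<dots> = (\<integral>\<^sup>+ z. ?I z * ennreal (norm (\<Phi> x z) powr p) \<partial>lborel)"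
      by (intro nn_integral_cong) (auto simp: indicator_def)
    finally show ?thesis .
  qed
  have "(\<integral>\<^sup>+ x. ennreal (norm (LINT z:{a..b}|lborel. \<Phi> x z) powr p) \<partial>lebesgue)
      \<le> (\<integral>\<^sup>+ x. ennreal ((b - a) powr (p - 1)) *
            (\<integral>\<^sup>+ z. ?I z * ennreal (norm (\<Phi> x z) powr p) \<partial>lborel) \<partial>lborel)"
    unfolding nn_integral_completion by (intro nn_integral_mono pt)
  also have "\<dots> = ennreal ((b - a) powr (p - 1)) *
      (\<integral>\<^sup>+ x. \<integral>\<^sup>+ z. ?I z * ennreal (norm (\<Phi> x z) powr p) \<partial>lborel \<partial>lborel)"
    by (rule nn_integral_cmult) measurable
  also have "(\<integral>\<^sup>+ x. \<integral>\<^sup>+ z. ?I z * ennreal (norm (\<Phi> x z) powr p) \<partial>lborel \<partial>lborel)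
      = (\<integral>\<^sup>+ z. \<integral>\<^sup>+ x. ?I z * ennreal (norm (\<Phi> x z) powr p) \<partial>lborel \<partial>lborel)"
    by (rule lborel_pair.Fubini'[symmetric]) measurable
  also have "\<dots> \<le> (\<integral>\<^sup>+ z. ennreal (c powr p) * ?I z \<partial>lborel)"
  proof (intro nn_integral_mono)
    fix z
    have "(\<integral>\<^sup>+ x. ennreal (norm (\<Phi> x z) powr p) \<partial>lborel) \<le> ennreal (c powr p)" if "z \<in> {a..b}"
      using le[OF that] real p Lp_norm_le_iff[of p c "\<lambda>x. \<Phi> x z"]
      by (simp add: nn_integral_completion)
    then show "(\<integral>\<^sup>+ x. ?I z * ennreal (norm (\<Phi> x z) powr p) \<partial>lborel) \<le> ennreal (c powr p) * ?I z"
      by (auto simp: indicator_def)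
  qed
  also have "\<dots> = ennreal (c powr p * (b - a))"
    using ab by (simp add: nn_integral_cmult ennreal_mult)
  finally have "(\<integral>\<^sup>+ x. ennreal (norm (LINT z:{a..b}|lborel. \<Phi> x z) powr p) \<partial>lebesgue)
      \<le> ennreal ((b - a) powr (p - 1)) * ennreal (c powr p * (b - a))"
    by (simp add: mult_left_mono)
  also have "\<dots> = ennreal (((b - a) * c) powr p)"
    using ab real by (simp add: powr_mult powr_diff flip: ennreal_mult)
  finally show ?thesis
    using ab real p by (simp add: Lp_norm_le_iff flip: ennreal_mult)
qed

section \<open>Finite differences and the modulus of smoothness\<close>

lemma fwd_diff_Suc: "fwd_diff (Suc s) h f = fwd_diff s h (\<lambda>x. f (x + h) - f x)"
proof
  fix x
  let ?g = "\<lambda>k. f (x + of_nat k * h)"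
  let ?c = "\<lambda>s k. of_nat (s choose k) * (- 1) ^ (s - k) :: 'a"
  have *: "?c (Suc s) (Suc k) * ?g (Suc k) = ?c s k * ?g (Suc k) - ?c s (Suc k) * ?g (Suc k)"
    if "k \<le> s" for k
  proof (cases "k = s")
    case False
    then have "s - k = Suc (s - Suc k)" using that by simp
    then show ?thesis by (simp add: algebra_simps)
  qed simp
  have "fwd_diff (Suc s) h f x = ?c (Suc s) 0 * ?g 0 + (\<Sum>k=0..s. ?c (Suc s) (Suc k) * ?g (Suc k))"
    unfolding fwd_diff_def by (subst sum.atLeast0_atMost_Suc_shift) (simp add: o_def)
  also have "(\<Sum>k=0..s. ?c (Suc s) (Suc k) * ?g (Suc k))
      = (\<Sum>k=0..s. ?c s k * ?g (Suc k) - ?c s (Suc k) * ?g (Suc k))"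
    by (intro sum.cong refl *) auto
  also have "?c (Suc s) 0 * ?g 0 + \<dots> = (\<Sum>k=0..s. ?c s k * ?g (Suc k))
      - (?c s 0 * ?g 0 + (\<Sum>k=0..s. ?c s (Suc k) * ?g (Suc k)))"
    unfolding sum_subtractf by simp
  also have "?c s 0 * ?g 0 + (\<Sum>k=0..s. ?c s (Suc k) * ?g (Suc k)) = (\<Sum>k=0..Suc s. ?c s k * ?g k)"
    by (subst sum.atLeast0_atMost_Suc_shift) (simp add: o_def)
  also have "\<dots> = (\<Sum>k=0..s. ?c s k * ?g k)"
    by simp
  finally show "fwd_diff (Suc s) h f x = fwd_diff s h (\<lambda>x. f (x + h) - f x) x"
    by (simp add: fwd_diff_def sum_subtractf algebra_simps)
qed

lemma fwd_diff_Suc': "fwd_diff (Suc s) h f x = fwd_diff s h f (x + h) - fwd_diff s h f x"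
  unfolding fwd_diff_Suc by (simp add: fwd_diff_def sum_subtractf algebra_simps)

lemma fwd_diff_0: "fwd_diff 0 h f = f"
  by (simp add: fwd_diff_def fun_eq_iff)

lemma fwd_diff_step_0:
  assumes "1 \<le> s"
  shows "fwd_diff s 0 f = (\<lambda>x. 0)"
proof -
  obtain s' where "s = Suc s'" using assms by (cases s) auto
  then show ?thesis by (auto simp: fwd_diff_Suc')
qed

lemma borel_measurable_translate_lebesgue [measurable]:
  assumes [measurable]: "f \<in> borel_measurable lebesgue"
  shows "(\<lambda>x::real. f (x + c)) \<in> borel_measurable lebesgue"
proof -
  have "(\<lambda>x::real. c + (1::real) *\<^sub>R x) \<in> lebesgue \<rightarrow>\<^sub>M lebesgue"
    using lebesgue_affine_measurable[of "\<lambda>_::real. 1::real" c] by simp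
  from measurable_compose[OF this assms] show ?thesis by (simp add: add.commute)
qed

lemma borel_measurable_fwd_diff_lebesgue [measurable]:
  fixes f :: "real \<Rightarrow> 'a::{real_normed_field, second_countable_topology}"
  assumes [measurable]: "f \<in> borel_measurable lebesgue"
  shows "fwd_diff s h f \<in> borel_measurable lebesgue"
  unfolding fwd_diff_def[abs_def] by measurable

text \<open>
  A further difference is a difference of two translates, and translation preserves the norm.
\<close>

lemma Lp_norm_fwd_diff_le:
  fixes f :: "real \<Rightarrow> 'a::{real_normed_field, second_countable_topology}"
  assumes p: "1 \<le> p" and [measurable]: "f \<in> borel_measurable lebesgue"
  shows "Lp_norm p (fwd_diff (s + n) h f) \<le> 2 ^ n * Lp_norm p (fwd_diff s h f)"
proof (induction n)
  case (Suc n)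
  let ?g = "fwd_diff (s + n) h f"
  have "Lp_norm p (fwd_diff (s + Suc n) h f) = Lp_norm p (\<lambda>x. ?g (x + h) + - ?g x)"
    by (rule Lp_norm_cong_AE) (simp add: fwd_diff_Suc')
  also have "\<dots> \<le> Lp_norm p (\<lambda>x. ?g (x + h)) + Lp_norm p (\<lambda>x. - ?g x)"
    by (rule Lp_norm_triangle[OF p]) measurable
  also have "Lp_norm p (\<lambda>x. ?g (x + h)) = Lp_norm p ?g"
    by (rule Lp_norm_translate) measurable
  also have "Lp_norm p (\<lambda>x. - ?g x) = Lp_norm p ?g"
    by (simp add: Lp_norm_def)
  also have "Lp_norm p ?g + Lp_norm p ?g = 2 * Lp_norm p ?g" by (simp add: mult_2)
  also have "\<dots> \<le> 2 * (2 ^ n * Lp_norm p (fwd_diff s h f))"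
    by (intro mult_left_mono Suc) auto
  finally show ?case by (simp add: mult.assoc)
qed simp

text \<open>
  The step \<open>h = 0\<close>, over which the supremum does not range, occurs at the corner
  \<open>t\<^sub>1 = \<dots> = t\<^sub>r = 0\<close> of the cube in the Steklov average; the difference vanishes there.
\<close>

lemma Lp_norm_fwd_diff_le_modulus:
  fixes f :: "real \<Rightarrow> 'a::{real_normed_field, second_countable_topology}"
  assumes p: "1 \<le> p" and f: "f \<in> borel_measurable lebesgue"
    and s: "1 \<le> s" "s \<le> r" and h: "0 \<le> h" "h \<le> \<delta>"
  shows "Lp_norm p (fwd_diff r h f) \<le> 2 ^ (r - s) * smoothness_modulus s f \<delta> p"
proof (cases "h = 0")
  case True
  then show ?thesis using s by (simp add: fwd_diff_step_0 Lp_norm_zero)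
next
  case False
  have "Lp_norm p (fwd_diff r h f) \<le> 2 ^ (r - s) * Lp_norm p (fwd_diff s h f)"
    using Lp_norm_fwd_diff_le[OF p f, of s "r - s" h] s by simp
  also have "\<dots> \<le> 2 ^ (r - s) * smoothness_modulus s f \<delta> p"
    unfolding smoothness_modulus_def using False h by (intro mult_left_mono SUP_upper) auto
  finally show ?thesis .
qed

section \<open>Iterated window integrals and their Taylor expansion\<close>

text \<open>
  The iterates of this operator are the \<open>n\<close>-fold integrals over \<open>[0, \<delta>]\<^sup>n\<close> of
  \<open>F (c + t\<^sub>1 + \<dots> + t\<^sub>n)\<close>. There is no normalising factor \<open>1 / \<delta>\<close>, so that the remainder in the
  Taylor expansion below carries no power of \<open>\<delta>\<close>.
\<close>

definition window_integral :: "real \<Rightarrow> (real \<Rightarrow> 'b) \<Rightarrow> real \<Rightarrow> 'b::{banach, second_countable_topology}"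
  where "window_integral \<delta> F c = (LINT t:{0..\<delta>}|lborel. F (c + t))"

lemma window_integral_Suc:
  "(window_integral \<delta> ^^ Suc n) F c = (LINT t:{0..\<delta>}|lborel. (window_integral \<delta> ^^ n) F (c + t))"
  by (simp add: window_integral_def)

lemma window_integral_measurable_param:
  fixes \<Phi> :: "real \<Rightarrow> real \<Rightarrow> 'b::{banach, second_countable_topology}"
  assumes "(\<lambda>(x, c). \<Phi> x c) \<in> borel_measurable (borel \<Otimes>\<^sub>M borel)"
  shows "(\<lambda>(x, c). (window_integral \<delta> ^^ n) (\<Phi> x) c) \<in> borel_measurable (borel \<Otimes>\<^sub>M borel)"
proof (induction n)
  case (Suc n)
  note [measurable] = Suc
  show ?case
    unfolding window_integral_Suc set_lebesgue_integral_def case_prod_beta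
    by (rule lborel.borel_measurable_lebesgue_integral) measurable
qed (use assms in simp)

lemma window_integral_measurable [measurable]:
  fixes F :: "real \<Rightarrow> 'b::{banach, second_countable_topology}"
  assumes [measurable]: "F \<in> borel_measurable borel"
  shows "(window_integral \<delta> ^^ n) F \<in> borel_measurable borel"
proof -
  have *: "(\<lambda>(x::real, c). F c) \<in> borel_measurable (borel \<Otimes>\<^sub>M borel)" by measurable
  have "(\<lambda>c. (0::real, c)) \<in> borel \<rightarrow>\<^sub>M borel \<Otimes>\<^sub>M borel" by measurable
  from measurable_compose[OF this window_integral_measurable_param[OF *]] show ?thesis by simp
qed

lemma window_integral_bound:
  fixes F :: "real \<Rightarrow> 'b::{banach, second_countable_topology}"
  assumes \<delta>: "0 \<le> \<delta>" and [measurable]: "F \<in> borel_measurable borel" and bd: "\<And>c. norm (F c) \<le> B"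
  shows "norm ((window_integral \<delta> ^^ n) F c) \<le> \<delta> ^ n * B"
proof (induction n arbitrary: c)
  case (Suc n)
  let ?G = "\<lambda>t. (window_integral \<delta> ^^ n) F (c + t)"
  have int: "set_integrable lborel {0..\<delta>} ?G"
    by (rule set_integrable_interval_bounded[OF _ Suc]) measurable
  have "norm (LINT t:{0..\<delta>}|lborel. ?G t) \<le> (LINT t:{0..\<delta>}|lborel. norm (?G t))"
    by (rule set_integral_norm_bound[OF int])
  also have "\<dots> \<le> (LINT t:{0..\<delta>}|lborel. \<delta> ^ n * B)"
    using int Suc by (intro set_integral_mono set_integrable_norm)
      (auto intro!: set_integrable_interval_bounded)
  also have "\<dots> = \<delta> ^ Suc n * B"
    using \<delta> by (simp add: set_integral_const)
  finally show ?case by (simp only: window_integral_Suc)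
qed (use bd in simp)

lemma window_integral_integrable:
  fixes F :: "real \<Rightarrow> 'b::{banach, second_countable_topology}"
  assumes "0 \<le> \<delta>" and F [measurable]: "F \<in> borel_measurable borel" and "\<And>c. norm (F c) \<le> B"
  shows "set_integrable lborel {a..b} (\<lambda>t. (window_integral \<delta> ^^ n) F (c + t))"
  by (rule set_integrable_interval_bounded[OF _ window_integral_bound[OF assms]]) measurable

lemma window_integral_diff:
  fixes F G :: "real \<Rightarrow> 'b::{banach, second_countable_topology}"
  assumes \<delta>: "0 \<le> \<delta>" and FG: "F \<in> borel_measurable borel" "G \<in> borel_measurable borel"
    and bd: "\<And>c. norm (F c) \<le> B" "\<And>c. norm (G c) \<le> B'"
  shows "(window_integral \<delta> ^^ n) (\<lambda>c. F c - G c) x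
    = (window_integral \<delta> ^^ n) F x - (window_integral \<delta> ^^ n) G x"
proof (induction n arbitrary: x)
  case (Suc n)
  then show ?case
    using window_integral_integrable[OF \<delta> FG(1) bd(1)] window_integral_integrable[OF \<delta> FG(2) bd(2)]
    by (simp add: window_integral_Suc set_integral_diff del: funpow.simps(2))
qed simp

lemma window_integral_sum:
  fixes F :: "'i \<Rightarrow> real \<Rightarrow> 'b::{banach, second_countable_topology}"
  assumes \<delta>: "0 \<le> \<delta>" and F: "\<And>i. i \<in> I \<Longrightarrow> F i \<in> borel_measurable borel"
    and bd: "\<And>i c. i \<in> I \<Longrightarrow> norm (F i c) \<le> B i"
  shows "(window_integral \<delta> ^^ n) (\<lambda>c. \<Sum>i\<in>I. F i c) x = (\<Sum>i\<in>I. (window_integral \<delta> ^^ n) (F i) x)"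
proof (induction n arbitrary: x)
  case (Suc n)
  then show ?case
    using window_integral_integrable[OF \<delta> F bd]
    by (simp add: window_integral_Suc set_lebesgue_integral_def set_integrable_def
        scaleR_sum_right Bochner_Integration.integral_sum del: funpow.simps(2))
qed simp

lemma window_integral_mult:
  fixes F :: "real \<Rightarrow> 'a::{real_normed_field, banach, second_countable_topology}"
  shows "(window_integral \<delta> ^^ n) (\<lambda>c. k * F c) x = k * (window_integral \<delta> ^^ n) F x"
  by (induction n arbitrary: x) (simp_all add: window_integral_Suc del: funpow.simps(2))

lemma window_integral_const:
  assumes "0 \<le> \<delta>"
  shows "(window_integral \<delta> ^^ n) (\<lambda>c. k) x = \<delta> ^ n *\<^sub>R k"
  using assms by (induction n arbitrary: x) (simp_all add: window_integral_Suc set_integral_const del: funpow.simps(2))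

lemma window_integral_shift:
  "(window_integral \<delta> ^^ n) (\<lambda>c. F (c + y)) x = (window_integral \<delta> ^^ n) F (x + y)"
  by (induction n arbitrary: x) (simp_all add: window_integral_Suc add_ac del: funpow.simps(2))

text \<open>
  Minkowski's integral inequality, once for every integration. The sums \<open>c0 + t\<^sub>1 + \<dots> + t\<^sub>n\<close>
  stay in an interval of length \<open>n \<delta>\<close>.
\<close>

lemma Lp_norm_window_integral_le:
  fixes \<Phi> :: "real \<Rightarrow> real \<Rightarrow> 'b::{banach, second_countable_topology}"
  assumes p: "1 \<le> p" and \<delta>: "0 < \<delta>"
    and meas: "(\<lambda>(x, c). \<Phi> x c) \<in> borel_measurable (borel \<Otimes>\<^sub>M borel)"
    and bd: "\<And>x c. norm (\<Phi> x c) \<le> B"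
    and le: "\<And>c. c \<in> {c0..c0 + real n * \<delta>} \<Longrightarrow> Lp_norm p (\<lambda>x. \<Phi> x c) \<le> C"
  shows "Lp_norm p (\<lambda>x. (window_integral \<delta> ^^ n) (\<Phi> x) c0) \<le> ennreal (\<delta> ^ n) * C"
  using le
proof (induction n arbitrary: c0)
  case (Suc n)
  let ?\<Psi> = "\<lambda>x t. (window_integral \<delta> ^^ n) (\<Phi> x) (c0 + t)"
  have sec: "\<Phi> x \<in> borel_measurable borel" for x
  proof -
    have "(\<lambda>c. (x, c)) \<in> borel \<rightarrow>\<^sub>M borel \<Otimes>\<^sub>M borel" by measurable
    from measurable_compose[OF this meas] show ?thesis by simp
  qed
  have "Lp_norm p (\<lambda>x. LINT t:{0..\<delta>}|lborel. ?\<Psi> x t) \<le> ennreal (\<delta> - 0) * (ennreal (\<delta> ^ n) * C)"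
  proof (rule Lp_norm_integral_le[OF p \<delta>])
    note [measurable] = window_integral_measurable_param[OF meas]
    show "(\<lambda>(x, z). ?\<Psi> x z) \<in> borel_measurable (borel \<Otimes>\<^sub>M borel)" by measurable
    show "norm (?\<Psi> x z) \<le> \<delta> ^ n * B" for x z
      using \<delta> bd sec by (intro window_integral_bound) auto
    show "Lp_norm p (\<lambda>x. ?\<Psi> x z) \<le> ennreal (\<delta> ^ n) * C" if "z \<in> {0..\<delta>}" for z
      using that by (intro Suc) (auto simp: algebra_simps)
  qed
  then show ?case
    using \<delta> by (simp add: window_integral_Suc ennreal_mult mult.assoc del: funpow.simps(2))
qed simp

text \<open>
  The right-hand side treats both orientations of the interval at once, so the proofs below need not
  distinguish \<open>x < y\<close> from \<open>y < x\<close>.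
\<close>

lemma oriented_integral_eq:
  fixes G :: "real \<Rightarrow> 'b::{banach, second_countable_topology}"
  shows "(LBINT v=ereal x..ereal y. G v) = (y - x) *\<^sub>R (LINT t:{0..1}|lborel. G (x + t * (y - x)))"
proof (cases x y rule: linorder_cases)
  case less
  have "indicator {x..y} (x + (y - x) * t) = (indicator {0..1} t :: real)" for t
  proof -
    have "x + (y - x) * t \<le> y \<longleftrightarrow> (y - x) * t \<le> (y - x) * 1" by (simp add: algebra_simps)
    also have "\<dots> \<longleftrightarrow> t \<le> 1" using less by (subst mult_le_cancel_left_pos) auto
    moreover have "x \<le> x + (y - x) * t \<longleftrightarrow> 0 \<le> t" using less by (simp add: zero_le_mult_iff)
    ultimately show ?thesis by (auto simp: indicator_def)
  qed
  then show ?thesis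
    using less lborel_integral_real_affine[of "y - x" "\<lambda>v. indicator {x..y} v *\<^sub>R G v" x]
    by (simp add: interval_integral_Icc set_lebesgue_integral_def mult.commute)
next
  case greater
  have "indicator {y..x} (x + (y - x) * t) = (indicator {0..1} t :: real)" for t
  proof -
    have "y \<le> x + (y - x) * t \<longleftrightarrow> (y - x) * 1 \<le> (y - x) * t" by (simp add: algebra_simps)
    also have "\<dots> \<longleftrightarrow> t \<le> 1" using greater by (subst mult_le_cancel_left_neg) auto
    moreover have "x + (y - x) * t \<le> x \<longleftrightarrow> 0 \<le> t" using greater by (simp add: mult_le_0_iff)
    ultimately show ?thesis by (auto simp: indicator_def)
  qed
  then show ?thesis
    using greater lborel_integral_real_affine[of "y - x" "\<lambda>v. indicator {y..x} v *\<^sub>R G v" x]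
    by (subst interval_integral_endpoints_reverse)
      (simp add: interval_integral_Icc set_lebesgue_integral_def mult.commute scaleR_left_diff_distrib)
qed (simp add: interval_integral_endpoints_same)

text \<open>
  This is the fundamental theorem of calculus for \<open>window_integral\<close>, whose derivative would be
  \<open>G (v + \<delta>) - G v\<close>: both sides compare the integrals over \<open>[y, y + \<delta>]\<close> and
  \<open>[x, x + \<delta>]\<close>, which differ by the integrals over \<open>[x + \<delta>, y + \<delta>]\<close> and \<open>[x, y]\<close>.
  In this form it holds for merely measurable \<open>G\<close>.
\<close>

lemma window_integral_increment:
  fixes G :: "real \<Rightarrow> 'b::{banach, second_countable_topology}"
  assumes \<delta>: "0 < \<delta>" and [measurable]: "G \<in> borel_measurable borel" and bd: "\<And>c. norm (G c) \<le> B"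
  shows "window_integral \<delta> G y - window_integral \<delta> G x
    = (y - x) *\<^sub>R (LINT t:{0..1}|lborel. G (x + t * (y - x) + \<delta>) - G (x + t * (y - x)))"
proof -
  let ?L = "\<lambda>a b. LBINT v=ereal a..ereal b. G v"
  have add: "?L a b + ?L b c = ?L a c" for a b c
  proof (rule interval_integral_sum)
    have "interval_lebesgue_integrable lborel (ereal l) (ereal u) G" for l u
      unfolding interval_lebesgue_integrable_def
      using set_integrable_subset[OF set_integrable_interval_bounded[OF assms(2) bd, of l u]]
        set_integrable_subset[OF set_integrable_interval_bounded[OF assms(2) bd, of u l]]
      by (auto simp: einterval_def subset_iff)
    from this[of "min a (min b c)" "max a (max b c)"]
    show "interval_lebesgue_integrable lborel (min (ereal a) (min (ereal b) (ereal c)))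
        (max (ereal a) (max (ereal b) (ereal c))) G"
      by (simp add: ereal_max ereal_min)
  qed
  have W: "window_integral \<delta> G u = ?L u (u + \<delta>)" for u
  proof -
    have "indicator {u..u + \<delta>} (u + t) = (indicator {0..\<delta>} t :: real)" for t
      by (auto simp: indicator_def)
    then show ?thesis
      using \<delta> lborel_integral_real_affine[of 1 "\<lambda>v. indicator {u..u + \<delta>} v *\<^sub>R G v" u]
      by (simp add: interval_integral_Icc set_lebesgue_integral_def window_integral_def)
  qed
  have int: "set_integrable lborel {0..1} (\<lambda>t. G (x + t * (y - x) + \<delta>))"
      "set_integrable lborel {0..1} (\<lambda>t. G (x + t * (y - x)))"
    by (rule set_integrable_interval_bounded[OF _ bd], measurable)+
  have "?L y (y + \<delta>) - ?L x (x + \<delta>) = ?L (x + \<delta>) (y + \<delta>) - ?L x y"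
    using add[of x y "y + \<delta>"] add[of x "x + \<delta>" "y + \<delta>"] by (simp add: algebra_simps)
  also have "\<dots> = (y - x) *\<^sub>R (LINT t:{0..1}|lborel. G (x + t * (y - x) + \<delta>))
      - (y - x) *\<^sub>R (LINT t:{0..1}|lborel. G (x + t * (y - x)))"
    unfolding oriented_integral_eq by (simp add: add_ac)
  finally show ?thesis
    using int by (simp add: W scaleR_diff_right)
qed

text \<open>
  Taylor's formula with the remainder expressed by a difference. For the induction, apply the
  expansion of order \<open>n\<close> to the first difference of \<open>F\<close>, which commutes with the iterated window
  integral, and integrate it from \<open>x\<close> to \<open>y\<close> by means of \<open>window_integral_increment\<close>. The
  integration raises the degree of the polynomial by one and multiplies the error by at most \<open>\<rho>\<close>.

  The coefficients depend on \<open>x\<close> only. That the constant one is the exact value at \<open>x\<close> matters: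
  a sampling operator satisfying the moment conditions maps the polynomial to its constant term at
  \<open>x\<close>.
\<close>

lemma window_integral_taylor:
  fixes F :: "real \<Rightarrow> 'a::{real_normed_field, banach, second_countable_topology}"
  assumes \<delta>: "0 < \<delta>" and "F \<in> borel_measurable borel" "\<And>c. norm (F c) \<le> B"
  shows "\<exists>a. a 0 = (window_integral \<delta> ^^ Suc n) F x \<and>
    (\<forall>\<rho> y. \<bar>y - x\<bar> \<le> \<rho> \<longrightarrow>
      norm ((window_integral \<delta> ^^ Suc n) F y - (\<Sum>j\<le>n. (y - x) ^ j *\<^sub>R a j))
        \<le> \<rho> ^ n * (LINT z:{- \<rho>..\<rho>}|lborel. norm (fwd_diff (Suc n) \<delta> F (x + z))))"
  using assms(2,3)
proof (induction n arbitrary: F B)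
  case (0 F B)
  note [measurable] = 0(1)
  let ?D = "\<lambda>v. F (v + \<delta>) - F v"
  have D: "fwd_diff (Suc 0) \<delta> F = ?D"
    by (simp add: fwd_diff_Suc fwd_diff_0)
  have Dbd: "norm (?D v) \<le> B + B" for v
    by (rule norm_triangle_le_diff) (rule add_mono[OF 0(2) 0(2)])
  have "norm (window_integral \<delta> F y - window_integral \<delta> F x)
      \<le> (LINT z:{- \<rho>..\<rho>}|lborel. norm (?D (x + z)))" if y: "\<bar>y - x\<bar> \<le> \<rho>" for \<rho> y
  proof (cases "y = x")
    case True
    then show ?thesis
      unfolding set_lebesgue_integral_def by (auto intro!: integral_nonneg_AE)
  next
    case False
    let ?g = "\<lambda>t. norm (?D (x + t * (y - x)))"
    have int: "set_integrable lborel {0..1} (\<lambda>t. ?D (x + t * (y - x)))"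
      by (rule set_integrable_interval_bounded[OF _ Dbd]) measurable
    have "norm (window_integral \<delta> F y - window_integral \<delta> F x)
        = \<bar>y - x\<bar> * norm (LINT t:{0..1}|lborel. ?D (x + t * (y - x)))"
      using window_integral_increment[OF \<delta> 0(1,2), of y x] by simp
    also have "\<dots> \<le> \<bar>y - x\<bar> * (LINT t:{0..1}|lborel. ?g t)"
      by (intro mult_left_mono set_integral_norm_bound int) auto
    also have "\<dots> \<le> \<bar>y - x\<bar> * (LINT t|lborel. indicator {- \<rho>..\<rho>} ((y - x) * t) * ?g t)"
    proof -
      have I: "integrable lborel (\<lambda>z. indicator {- \<rho>..\<rho>} z *\<^sub>R norm (?D (x + z)))"
        using set_integrable_interval_bounded[of "\<lambda>z. norm (?D (x + z))" "B + B" "- \<rho>" \<rho>] Dbd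
        unfolding set_integrable_def by simp
      have "integrable lborel (\<lambda>t. indicator {- \<rho>..\<rho>} ((y - x) * t) * ?g t)"
        using lborel_integrable_real_affine[OF I, of "y - x" 0] False by (simp add: mult.commute)
      moreover have "indicator {0..1} t * ?g t \<le> indicator {- \<rho>..\<rho>} ((y - x) * t) * ?g t" for t
      proof (cases "t \<in> {0..1}")
        case True
        then have "\<bar>(y - x) * t\<bar> \<le> \<rho> * 1"
          unfolding abs_mult using y by (intro mult_mono) auto
        then have "(y - x) * t \<in> {- \<rho>..\<rho>}" by (auto simp: abs_le_iff)
        then show ?thesis using True by simp
      qed simp
      ultimately show ?thesis
        using set_integrable_norm[OF int] unfolding set_lebesgue_integral_def set_integrable_def
        by (intro mult_left_mono integral_mono) auto
    qed
    also have "\<dots> = (LINT z:{- \<rho>..\<rho>}|lborel. norm (?D (x + z)))"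
      using lborel_integral_real_affine[of "y - x" "\<lambda>z. indicator {- \<rho>..\<rho>} z *\<^sub>R norm (?D (x + z))" 0] False
      by (simp add: set_lebesgue_integral_def mult.commute)
    finally show ?thesis .
  qed
  then show ?case
    by (intro exI[of _ "\<lambda>_. window_integral \<delta> F x"]) (auto simp: D)
next
  case (Suc n F B)
  note [measurable] = Suc.prems(1)
  let ?D = "\<lambda>v. F (v + \<delta>) - F v"
  let ?W = "(window_integral \<delta> ^^ Suc n)"
  have Dm: "?D \<in> borel_measurable borel" by measurable
  have Dbd: "norm (?D v) \<le> B + B" for v
    by (rule norm_triangle_le_diff) (rule add_mono[OF Suc.prems(2) Suc.prems(2)])
  obtain a where a: "\<And>\<rho> y. \<bar>y - x\<bar> \<le> \<rho> \<Longrightarrow>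
      norm (?W ?D y - (\<Sum>j\<le>n. (y - x) ^ j *\<^sub>R a j))
        \<le> \<rho> ^ n * (LINT z:{- \<rho>..\<rho>}|lborel. norm (fwd_diff (Suc n) \<delta> ?D (x + z)))"
    using Suc.IH[OF Dm Dbd] by blast
  \<comment> \<open>term by term antiderivative of the expansion of the first difference\<close>
  define b where "b j = (case j of 0 \<Rightarrow> (window_integral \<delta> ^^ Suc (Suc n)) F x
      | Suc i \<Rightarrow> (1 / real (Suc i)) *\<^sub>R a i)" for j
  have "norm ((window_integral \<delta> ^^ Suc (Suc n)) F y - (\<Sum>j\<le>Suc n. (y - x) ^ j *\<^sub>R b j))
      \<le> \<rho> ^ Suc n * (LINT z:{- \<rho>..\<rho>}|lborel. norm (fwd_diff (Suc (Suc n)) \<delta> F (x + z)))"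
    if y: "\<bar>y - x\<bar> \<le> \<rho>" for \<rho> y
  proof -
    let ?I = "LINT z:{- \<rho>..\<rho>}|lborel. norm (fwd_diff (Suc n) \<delta> ?D (x + z))"
    let ?P = "\<lambda>v. \<Sum>j\<le>n. v ^ j *\<^sub>R a j"
    let ?v = "\<lambda>t. x + t * (y - x)"
    have int1: "set_integrable lborel {0..1} (\<lambda>t. ?W ?D (?v t))"
      by (rule set_integrable_interval_bounded[OF _ window_integral_bound[OF less_imp_le[OF \<delta>] Dm Dbd]])
        (rule measurable_compose[OF _ window_integral_measurable[OF Dm]], measurable)
    have int2: "set_integrable lborel {0..1} (\<lambda>t. ?P (t * (y - x)))"
      by (intro borel_integrable_atLeastAtMost' continuous_intros)
    have W: "(window_integral \<delta> ^^ Suc (Suc n)) F y - (window_integral \<delta> ^^ Suc (Suc n)) F x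
        = (y - x) *\<^sub>R (LINT t:{0..1}|lborel. ?W ?D (?v t))"
    proof -
      have "?W F (v + \<delta>) - ?W F v = ?W ?D v" for v
      proof -
        have m: "(\<lambda>c. F (c + \<delta>)) \<in> borel_measurable borel" by measurable
        have "?W ?D v = ?W (\<lambda>c. F (c + \<delta>)) v - ?W F v"
          by (rule window_integral_diff[OF less_imp_le[OF \<delta>] m Suc.prems(1) Suc.prems(2) Suc.prems(2)])
        then show ?thesis by (simp only: window_integral_shift)
      qed
      then show ?thesis
        using window_integral_increment[OF \<delta> window_integral_measurable[OF Suc.prems(1)]
            window_integral_bound[OF less_imp_le[OF \<delta>] Suc.prems], of "Suc n" y x]
        by simp
    qed
    have "(\<Sum>j\<le>Suc n. (y - x) ^ j *\<^sub>R b j)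
        = (window_integral \<delta> ^^ Suc (Suc n)) F x + (\<Sum>j\<le>n. (y - x) ^ Suc j *\<^sub>R (1 / real (Suc j)) *\<^sub>R a j)"
      unfolding sum.atMost_Suc_shift by (simp add: b_def)
    also have "(\<Sum>j\<le>n. (y - x) ^ Suc j *\<^sub>R (1 / real (Suc j)) *\<^sub>R a j)
        = (y - x) *\<^sub>R (LINT t:{0..1}|lborel. ?P (t * (y - x)))"
    proof -
      have one: "integrable lborel (\<lambda>t::real. indicator {0..1} t * t ^ j :: real)"
        "(LINT t::real|lborel. indicator {0..1} t * t ^ j) = 1 / real (Suc j)" for j :: nat
      proof -
        have "set_integrable lborel {0..1} (\<lambda>t::real. t ^ j)"
          by (intro borel_integrable_atLeastAtMost' continuous_intros)
        then show "integrable lborel (\<lambda>t::real. indicator {0..1} t * t ^ j :: real)"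
          by (simp add: set_integrable_def)
        show "(LINT t::real|lborel. indicator {0..1} t * t ^ j) = 1 / real (Suc j)"
          using integral_power[of 0 1 j] by (simp add: mult.commute)
      qed
      have "indicator {0..1} t *\<^sub>R ?P (t * (y - x))
          = (\<Sum>j\<le>n. (indicator {0..1} t * t ^ j) *\<^sub>R ((y - x) ^ j *\<^sub>R a j))" for t
        by (simp add: scaleR_sum_right power_mult_distrib mult_ac)
      then have "(LINT t:{0..1}|lborel. ?P (t * (y - x)))
          = (\<Sum>j\<le>n. (1 / real (Suc j)) *\<^sub>R ((y - x) ^ j *\<^sub>R a j))"
        unfolding set_lebesgue_integral_def
        by (simp add: Bochner_Integration.integral_sum one del: scaleR_scaleR)
      then show ?thesis by (simp add: scaleR_sum_right mult_ac)
    qed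
    finally have "(window_integral \<delta> ^^ Suc (Suc n)) F y - (\<Sum>j\<le>Suc n. (y - x) ^ j *\<^sub>R b j)
        = (y - x) *\<^sub>R ((LINT t:{0..1}|lborel. ?W ?D (?v t)) - (LINT t:{0..1}|lborel. ?P (t * (y - x))))"
      by (simp only: scaleR_diff_right W[symmetric] diff_diff_eq)
    also have "(LINT t:{0..1}|lborel. ?W ?D (?v t)) - (LINT t:{0..1}|lborel. ?P (t * (y - x)))
        = (LINT t:{0..1}|lborel. ?W ?D (?v t) - ?P (t * (y - x)))"
      by (rule set_integral_diff(2)[OF int1 int2, symmetric])
    finally have eq: "(window_integral \<delta> ^^ Suc (Suc n)) F y - (\<Sum>j\<le>Suc n. (y - x) ^ j *\<^sub>R b j)
        = (y - x) *\<^sub>R (LINT t:{0..1}|lborel. ?W ?D (?v t) - ?P (t * (y - x)))" .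
    have \<rho>: "0 \<le> \<rho>" using y by linarith
    have I0: "0 \<le> ?I"
      unfolding set_lebesgue_integral_def by (auto intro!: integral_nonneg_AE)
    have int: "set_integrable lborel {0..1} (\<lambda>t. ?W ?D (?v t) - ?P (t * (y - x)))"
      by (rule set_integral_diff(1)[OF int1 int2])
    have "norm (LINT t:{0..1}|lborel. ?W ?D (?v t) - ?P (t * (y - x)))
        \<le> (LINT t:{0..1}|lborel. norm (?W ?D (?v t) - ?P (t * (y - x))))"
      by (rule set_integral_norm_bound[OF int])
    also have "\<dots> \<le> (LINT t:{0..1::real}|lborel. \<rho> ^ n * ?I)"
    proof (rule set_integral_mono)
      show "set_integrable lborel {0..1} (\<lambda>t. norm (?W ?D (?v t) - ?P (t * (y - x))))"
        by (rule set_integrable_norm[OF int])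
      show "set_integrable lborel {0..1::real} (\<lambda>t. \<rho> ^ n * ?I)"
        by (rule set_integrable_interval_bounded[of _ "norm (\<rho> ^ n * ?I)"]) auto
      fix t :: real assume t: "t \<in> {0..1}"
      have "\<bar>?v t - x\<bar> \<le> 1 * \<rho>"
        unfolding add_diff_cancel_left' abs_mult using y t by (intro mult_mono) auto
      then have "norm (?W ?D (?v t) - ?P (?v t - x)) \<le> \<rho> ^ n * ?I"
        using a[of "?v t" \<rho>] by simp
      then show "norm (?W ?D (?v t) - ?P (t * (y - x))) \<le> \<rho> ^ n * ?I" by simp
    qed
    also have "\<dots> = \<rho> ^ n * ?I" by (simp add: set_integral_const)
    finally have "\<bar>y - x\<bar> * norm (LINT t:{0..1}|lborel. ?W ?D (?v t) - ?P (t * (y - x))) \<le> \<rho> * (\<rho> ^ n * ?I)"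
      using y \<rho> I0 by (intro mult_mono) auto
    then show ?thesis
      unfolding eq fwd_diff_Suc[of "Suc n"] by (simp add: mult.assoc)
  qed
  then show ?case
    by (intro exI[of _ b]) (auto simp: b_def)
qed

section \<open>Borel representatives of Lebesgue measurable functions\<close>

lemma AE_lebesgue_affine:
  fixes P :: "real \<Rightarrow> bool"
  assumes c: "c \<noteq> 0" and P: "AE x in lebesgue. P x"
  shows "AE x in lebesgue. P (t + c * x)"
proof -
  have "AE x in lborel. P x" using P by (simp add: AE_completion_iff)
  then obtain N where N: "N \<in> null_sets lborel" "\<And>x. x \<notin> N \<Longrightarrow> P x"
    by (rule AE_E3) auto
  have [measurable]: "N \<in> sets borel" using N(1) by auto
  have "AE x in lborel. t + c * x \<notin> N"
    using AE_not_in[OF N(1)] by (intro AE_borel_affine[OF c]) auto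
  then have "AE x in lborel. P (t + c * x)"
    using N(2) by (auto elim!: eventually_mono)
  then show ?thesis by (simp add: AE_completion_iff)
qed

lemma borel_measurable_affine_lebesgue:
  fixes f :: "real \<Rightarrow> 'b::topological_space"
  assumes "c \<noteq> 0" "f \<in> borel_measurable lebesgue"
  shows "(\<lambda>x. f (t + c * x)) \<in> borel_measurable lebesgue"
  using measurable_compose[OF lebesgue_affine_measurable[of "\<lambda>_::real. c" t] assms(2)] assms(1)
  by simp

text \<open>
  Approximate \<open>f\<close> by simple functions, change each of them on a null set to make it Borel, and set
  the limit to \<open>0\<close> on a Borel null set that contains all the exceptional sets.
\<close>

lemma ex_bounded_borel_version:
  fixes f :: "real \<Rightarrow> 'b::{real_normed_vector, second_countable_topology}"
  assumes f: "f \<in> borel_measurable lebesgue" and bd: "\<And>x. norm (f x) \<le> B"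
  obtains g where "g \<in> borel_measurable borel" "\<And>x. norm (g x) \<le> B" "AE x in lebesgue. f x = g x"
proof -
  from borel_measurable_implies_sequence_metric[OF f, of 0]
  obtain F where F': "(\<forall>i. simple_function lebesgue (F i)) \<and> (\<forall>x\<in>space lebesgue. (\<lambda>i. F i x) \<longlonglongrightarrow> f x) \<and>
      (\<forall>i. \<forall>x\<in>space lebesgue. dist (F i x) 0 \<le> 2 * dist (f x) 0)"
    by (rule exE)
  have F: "simple_function lebesgue (F i)" "(\<lambda>i. F i x) \<longlonglongrightarrow> f x" for i x
    using F' by simp_all
  have "\<forall>i. \<exists>G. simple_function lborel G \<and> (AE x in lborel. F i x = G x)"
    by (intro allI completion_ex_simple_function F(1))
  then obtain G where "\<forall>i. simple_function lborel (G i) \<and> (AE x in lborel. F i x = G i x)"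
    unfolding choice_iff by (rule exE)
  then have G: "simple_function lborel (G i)" "AE x in lborel. F i x = G i x" for i
    by simp_all
  have "AE x in lborel. \<forall>i. F i x = G i x"
    using G(2) by (simp add: AE_all_countable)
  then obtain N where N: "N \<in> null_sets lborel" "\<And>x. x \<notin> N \<Longrightarrow> \<forall>i. F i x = G i x"
    by (rule AE_E3) auto
  have [measurable]: "N \<in> sets borel" using N(1) by auto
  have [measurable]: "G i \<in> borel_measurable borel" for i
    using borel_measurable_simple_function[OF G(1)] by simp
  define g where "g x = indicator (- N) x *\<^sub>R f x" for x
  have "g \<in> borel_measurable borel"
  proof (rule borel_measurable_LIMSEQ_metric)
    show "(\<lambda>x. indicator (- N) x *\<^sub>R G i x) \<in> borel_measurable borel" for i by measurable
    show "(\<lambda>i. indicator (- N) x *\<^sub>R G i x) \<longlonglongrightarrow> g x" for x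
    proof (cases "x \<in> N")
      case False
      then have "F i x = G i x" for i using N(2) by auto
      then show ?thesis using F(2)[of x] False by (simp add: g_def)
    qed (simp add: g_def)
  qed
  moreover have "norm (g x) \<le> B" for x
    using bd[of x] order_trans[OF norm_ge_zero bd[of x]] by (simp add: g_def indicator_def)
  moreover have "AE x in lebesgue. f x = g x"
    using AE_completion[OF AE_not_in[OF N(1)]] by (auto elim!: eventually_mono simp: g_def)
  ultimately show ?thesis by (rule that)
qed

lemma smoothness_modulus_cong_AE:
  fixes f g :: "real \<Rightarrow> 'a::real_normed_field"
  assumes fg: "AE x in lebesgue. f x = g x"
  shows "smoothness_modulus s f \<delta> p = smoothness_modulus s g \<delta> p"
proof -
  have "Lp_norm p (fwd_diff s h f) = Lp_norm p (fwd_diff s h g)" for h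
  proof (rule Lp_norm_cong_AE)
    have "AE x in lebesgue. f (x + of_nat k * h) = g (x + of_nat k * h)" for k
      using AE_lebesgue_affine[of 1 "\<lambda>x. f x = g x" "of_nat k * h", OF _ fg]
      by (simp add: add.commute)
    then have "AE x in lebesgue. \<forall>k::nat. f (x + of_nat k * h) = g (x + of_nat k * h)"
      by (simp add: AE_all_countable)
    then show "AE x in lebesgue. fwd_diff s h f x = fwd_diff s h g x"
      by (auto elim!: eventually_mono simp: fwd_diff_def)
  qed
  then show ?thesis by (simp add: smoothness_modulus_def)
qed

section \<open>Steklov averages\<close>

lemma set_integral_lebesgue_eq_lborel:
  fixes F G :: "real \<Rightarrow> 'b::{banach, second_countable_topology}"
  assumes [measurable]: "F \<in> borel_measurable lebesgue" "G \<in> borel_measurable borel"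
    and "AE x in lebesgue. F x = G x"
  shows "(LINT t:{a..b}|lebesgue. F t) = (LINT t:{a..b}|lborel. G t)"
proof -
  have G: "(\<lambda>t. indicator {a..b} t *\<^sub>R G t) \<in> borel_measurable lborel" by measurable
  have "(LINT t:{a..b}|lebesgue. F t) = (LINT t:{a..b}|lebesgue. G t)"
    unfolding set_lebesgue_integral_def
  proof (rule integral_cong_AE)
    show "(\<lambda>t. indicator {a..b} t *\<^sub>R F t) \<in> borel_measurable lebesgue"
      by (intro borel_measurable_scaleR borel_measurable_indicator assms(1)) simp
    show "AE t in lebesgue. indicator {a..b} t *\<^sub>R F t = indicator {a..b} t *\<^sub>R G t"
      using assms(3) by (auto elim!: eventually_mono)
  qed (rule measurable_completion[OF G])
  also have "\<dots> = (LINT t:{a..b}|lborel. G t)"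
    unfolding set_lebesgue_integral_def by (rule integral_completion) measurable
  finally show ?thesis .
qed

text \<open>
  One integration already forgets values on null sets. That is why \<open>F\<close> may be replaced by a Borel
  version, and why the number of integrations is \<open>Suc n\<close>.
\<close>

lemma iter_integral_eq_window_integral:
  fixes F G :: "real \<Rightarrow> 'b::{banach, second_countable_topology}"
  assumes F: "F \<in> borel_measurable lebesgue" and G [measurable]: "G \<in> borel_measurable borel"
    and FG: "AE x in lebesgue. F x = G x"
  shows "iter_integral \<delta> (Suc n) (\<lambda>ts. F (c + sum_list ts)) = (window_integral \<delta> ^^ Suc n) G c"
proof (induction n arbitrary: c)
  case 0
  have "(LINT t:{0..\<delta>}|lebesgue. F (c + t)) = (LINT t:{0..\<delta>}|lborel. G (c + t))"
  proof (rule set_integral_lebesgue_eq_lborel)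
    show "(\<lambda>t. F (c + t)) \<in> borel_measurable lebesgue"
      using borel_measurable_affine_lebesgue[OF _ F, of 1 c] by simp
    show "AE t in lebesgue. F (c + t) = G (c + t)"
      using AE_lebesgue_affine[of 1 "\<lambda>x. F x = G x" c] FG by simp
  qed measurable
  then show ?case by (simp add: window_integral_def)
next
  case (Suc n)
  have "iter_integral \<delta> (Suc (Suc n)) (\<lambda>ts. F (c + sum_list ts))
      = (LINT t:{0..\<delta>}|lebesgue. iter_integral \<delta> (Suc n) (\<lambda>ts. F ((c + t) + sum_list ts)))"
    by (simp add: add.assoc)
  also have "\<dots> = (LINT t:{0..\<delta>}|lebesgue. (window_integral \<delta> ^^ Suc n) G (c + t))"
    by (simp only: Suc)
  also have "\<dots> = (LINT t:{0..\<delta>}|lborel. (window_integral \<delta> ^^ Suc n) G (c + t))"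
  proof -
    have m: "(\<lambda>t. (window_integral \<delta> ^^ Suc n) G (c + t)) \<in> borel_measurable borel"
      by (rule measurable_compose[OF _ window_integral_measurable[OF G]]) measurable
    then have "(\<lambda>t. (window_integral \<delta> ^^ Suc n) G (c + t)) \<in> borel_measurable lebesgue"
      by (intro measurable_completion) (simp only: measurable_lborel2)
    from set_integral_lebesgue_eq_lborel[OF this m] show ?thesis by simp
  qed
  finally show ?case by (simp only: window_integral_Suc)
qed

lemma steklov_eq_window_integral:
  fixes f g :: "real \<Rightarrow> 'a::{real_normed_field, banach, second_countable_topology}"
  assumes r: "1 \<le> r" and f: "f \<in> borel_measurable lebesgue" and [measurable]: "g \<in> borel_measurable borel"
    and fg: "AE x in lebesgue. f x = g x"
  shows "steklov \<delta> r f x = ((- \<delta>) powi (- int r)) *\<^sub>R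
    (window_integral \<delta> ^^ r) (\<lambda>c. \<Sum>m=1..r. (- 1) ^ (r - m + 1) * of_nat (r choose m)
      * g (x + of_nat m / of_nat r * c)) 0"
proof -
  let ?F = "\<lambda>f c. \<Sum>m=1..r. (- 1) ^ (r - m + 1) * of_nat (r choose m) * f (x + of_nat m / of_nat r * c)"
  have nz: "real m / real r \<noteq> 0" if "m \<in> {1..r}" for m using that r by auto
  have "?F f \<in> borel_measurable lebesgue"
  proof (intro borel_measurable_sum borel_measurable_times borel_measurable_const)
    fix m assume "m \<in> {1..r}"
    from borel_measurable_affine_lebesgue[OF nz[OF this] f, of x]
    show "(\<lambda>c. f (x + of_nat m / of_nat r * c)) \<in> borel_measurable lebesgue" .
  qed
  moreover have "AE c in lebesgue. ?F f c = ?F g c"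
  proof -
    have "AE c in lebesgue. \<forall>m\<in>{1..r}. f (x + of_nat m / of_nat r * c) = g (x + of_nat m / of_nat r * c)"
    proof (rule AE_finite_allI)
      fix m assume "m \<in> {1..r}"
      from AE_lebesgue_affine[of "real m / real r" "\<lambda>x. f x = g x" x, OF nz[OF this] fg]
      show "AE c in lebesgue. f (x + of_nat m / of_nat r * c) = g (x + of_nat m / of_nat r * c)" .
    qed simp
    then show ?thesis by (rule eventually_mono) (auto intro!: sum.cong)
  qed
  moreover have "?F g \<in> borel_measurable borel" by measurable
  ultimately have *: "iter_integral \<delta> (Suc (r - 1)) (\<lambda>ts. ?F f (0 + sum_list ts))
      = (window_integral \<delta> ^^ Suc (r - 1)) (?F g) 0"
    by (intro iter_integral_eq_window_integral)
  have r': "Suc (r - 1) = r" using r by simp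
  show ?thesis
    unfolding steklov_def using *[unfolded r' add_0_left] by (rule arg_cong)
qed

lemma borel_measurable_steklov:
  fixes g :: "real \<Rightarrow> 'a::{real_normed_field, banach, second_countable_topology}"
  assumes r: "1 \<le> r" and g [measurable]: "g \<in> borel_measurable borel"
  shows "steklov \<delta> r g \<in> borel_measurable borel"
proof -
  let ?\<Phi> = "\<lambda>x c. \<Sum>m=1..r. (- 1) ^ (r - m + 1) * of_nat (r choose m) * g (x + of_nat m / of_nat r * c)"
  have gm: "g \<in> borel_measurable lebesgue"
    using g by (intro measurable_completion) simp
  have "(\<lambda>(x, c). ?\<Phi> x c) \<in> borel_measurable (borel \<Otimes>\<^sub>M borel)" by measurable
  note meas = window_integral_measurable_param[OF this, where \<delta> = \<delta> and n = r]
  have "(\<lambda>x. (x, 0::real)) \<in> borel \<rightarrow>\<^sub>M borel \<Otimes>\<^sub>M borel" by measurable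
  from measurable_compose[OF this meas]
  have m: "(\<lambda>x. (window_integral \<delta> ^^ r) (?\<Phi> x) 0) \<in> borel_measurable borel"
    by (simp only: case_prod_conv)
  have eq: "steklov \<delta> r g = (\<lambda>x. ((- \<delta>) powi (- int r)) *\<^sub>R (window_integral \<delta> ^^ r) (?\<Phi> x) 0)"
    by (rule ext, rule steklov_eq_window_integral[OF r gm g]) (rule AE_I2, rule refl)
  show ?thesis
    unfolding eq by (rule borel_measurable_scaleR[OF borel_measurable_const m])
qed

lemma fwd_diff_bound:
  fixes f :: "real \<Rightarrow> 'a::real_normed_field"
  assumes "\<And>x. norm (f x) \<le> B"
  shows "norm (fwd_diff s h f x) \<le> (\<Sum>k=0..s. real (s choose k) * B)"
  unfolding fwd_diff_def
  by (rule sum_norm_le) (auto simp: norm_mult norm_power intro!: mult_left_mono assms)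

text \<open>
  The coefficients of \<open>steklov\<close> are those of the \<open>r\<close>-th difference with step \<open>(t\<^sub>1 + \<dots> + t\<^sub>r) / r\<close>
  without its term \<open>m = 0\<close>. The factor \<open>(-\<delta>)\<^sup>-\<^sup>r\<close> is such that the missing term contributes exactly
  \<open>g x\<close>.
\<close>

lemma steklov_minus_eq:
  fixes g :: "real \<Rightarrow> 'a::{real_normed_field, banach, second_countable_topology}"
  assumes r: "1 \<le> r" and \<delta>: "0 < \<delta>" and g [measurable]: "g \<in> borel_measurable borel"
    and bd: "\<And>x. norm (g x) \<le> B"
  shows "steklov \<delta> r g x - g x
    = ((- \<delta>) powi (- int r)) *\<^sub>R (window_integral \<delta> ^^ r) (\<lambda>c. - fwd_diff r (c / real r) g x) 0"
proof -
  let ?F = "\<lambda>c. \<Sum>m=1..r. (- 1) ^ (r - m + 1) * of_nat (r choose m) * g (x + of_nat m / of_nat r * c)"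
  let ?k = "(- 1) ^ r * g x"
  have gm: "g \<in> borel_measurable lebesgue"
    using g by (intro measurable_completion) simp
  have "- fwd_diff r (c / real r) g x = ?F c - ?k" for c
  proof -
    have "fwd_diff r (c / real r) g x = ?k + (\<Sum>m=1..r. of_nat (r choose m) * (- 1) ^ (r - m) * g (x + of_nat m * (c / real r)))"
      unfolding fwd_diff_def by (subst sum.atLeast_Suc_atMost) auto
    moreover have "(\<Sum>m=1..r. of_nat (r choose m) * (- 1) ^ (r - m) * g (x + of_nat m * (c / real r))) = - ?F c"
      unfolding sum_negf[symmetric] by (intro sum.cong refl) (simp add: mult.commute)
    ultimately show ?thesis by simp
  qed
  moreover have "(window_integral \<delta> ^^ r) (\<lambda>c. ?F c - ?k) 0
      = (window_integral \<delta> ^^ r) ?F 0 - (window_integral \<delta> ^^ r) (\<lambda>c. ?k) 0"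
  proof (rule window_integral_diff)
    show "?F \<in> borel_measurable borel" by measurable
    show "norm (?F c) \<le> (\<Sum>m=1..r. real (r choose m) * B)" for c
      by (rule sum_norm_le) (auto simp: norm_mult norm_power intro!: mult_left_mono bd)
  qed (use \<delta> in auto)
  moreover have "((- \<delta>) powi (- int r)) *\<^sub>R (window_integral \<delta> ^^ r) (\<lambda>c. ?k) 0 = g x"
  proof -
    have "((- \<delta>) powi (- int r)) * \<delta> ^ r = (- 1) ^ r"
      using \<delta> by (simp add: power_int_minus power_minus[of \<delta>] field_simps)
    then have "((- \<delta>) powi (- int r)) *\<^sub>R (window_integral \<delta> ^^ r) (\<lambda>c. ?k) 0 = (- 1) ^ r *\<^sub>R ?k"
      using \<delta> by (simp add: window_integral_const)
    also have "\<dots> = g x" by (cases "even r") auto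
    finally show ?thesis .
  qed
  ultimately show ?thesis
    using steklov_eq_window_integral[OF r gm g, of \<delta> x] by (simp add: scaleR_diff_right)
qed

text \<open>
  The \<open>r\<close>-fold integral costs a factor \<open>\<delta>\<^sup>r\<close>, which the normalisation of the Steklov average
  cancels.
\<close>

lemma Lp_norm_steklov_minus_le:
  fixes g :: "real \<Rightarrow> 'a::{real_normed_field, banach, second_countable_topology}"
  assumes p: "1 \<le> p" and s: "1 \<le> s" "s \<le> r" and \<delta>: "0 < \<delta>"
    and g [measurable]: "g \<in> borel_measurable borel" and bd: "\<And>x. norm (g x) \<le> B"
  shows "Lp_norm p (\<lambda>x. steklov \<delta> r g x - g x) \<le> 2 ^ (r - s) * smoothness_modulus s g \<delta> p"
    (is "_ \<le> ?C")
proof -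
  have r: "1 \<le> r" using s by simp
  have gm: "g \<in> borel_measurable lebesgue"
    using g by (intro measurable_completion) simp
  let ?\<Phi> = "\<lambda>x c. - fwd_diff r (c / real r) g x"
  let ?Q = "\<lambda>x. (window_integral \<delta> ^^ r) (?\<Phi> x) 0"
  have meas: "(\<lambda>(x, c). ?\<Phi> x c) \<in> borel_measurable (borel \<Otimes>\<^sub>M borel)"
    unfolding fwd_diff_def by measurable
  have "(\<lambda>x. (x, 0::real)) \<in> borel \<rightarrow>\<^sub>M borel \<Otimes>\<^sub>M borel" by measurable
  from measurable_compose[OF this window_integral_measurable_param[OF meas, where \<delta> = \<delta> and n = r]]
  have Qm: "?Q \<in> borel_measurable lebesgue"
    by (intro measurable_completion) simp
  have "Lp_norm p ?Q \<le> ennreal (\<delta> ^ r) * ?C"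
  proof (rule Lp_norm_window_integral_le[OF p \<delta> meas])
    show "norm (?\<Phi> x c) \<le> (\<Sum>k=0..r. real (r choose k) * B)" for x c
      using fwd_diff_bound[of g, OF bd] by simp
    fix c assume "c \<in> {0..0 + real r * \<delta>}"
    then have "0 \<le> c / real r" "c / real r \<le> \<delta>" using r by (auto simp: field_simps)
    from Lp_norm_fwd_diff_le_modulus[OF p gm s this]
    show "Lp_norm p (\<lambda>x. ?\<Phi> x c) \<le> ?C" by (simp add: Lp_norm_def)
  qed
  have "Lp_norm p (\<lambda>x. steklov \<delta> r g x - g x) \<le> ennreal (inverse (\<delta> ^ r)) * Lp_norm p ?Q"
    using p \<delta> by (intro Lp_norm_bound_cmult[OF _ _ Qm])
      (auto simp: steklov_minus_eq[OF r \<delta> g bd] power_int_minus norm_power)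
  also have "\<dots> \<le> ennreal (inverse (\<delta> ^ r)) * (ennreal (\<delta> ^ r) * ?C)"
    by (intro mult_left_mono \<open>Lp_norm p ?Q \<le> ennreal (\<delta> ^ r) * ?C\<close>) simp
  also have "\<dots> = ?C"
    using \<delta> by (simp flip: mult.assoc ennreal_mult)
  finally show ?thesis .
qed

text \<open>
  The building blocks of the Steklov average, which combines them for \<open>a = m / r\<close>.
\<close>

definition dilated_average :: "real \<Rightarrow> nat \<Rightarrow> real \<Rightarrow> (real \<Rightarrow> 'b) \<Rightarrow> real \<Rightarrow> 'b::{banach, second_countable_topology}"
  where "dilated_average \<delta> r a g y = (window_integral \<delta> ^^ r) (\<lambda>c. g (y + a * c)) 0"

lemma steklov_eq_dilated_averages:
  fixes g :: "real \<Rightarrow> 'a::{real_normed_field, banach, second_countable_topology}"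
  assumes r: "1 \<le> r" and \<delta>: "0 < \<delta>" and g [measurable]: "g \<in> borel_measurable borel"
    and bd: "\<And>x. norm (g x) \<le> B"
  shows "steklov \<delta> r g y = ((- \<delta>) powi (- int r)) *\<^sub>R
    (\<Sum>m=1..r. (- 1) ^ (r - m + 1) * of_nat (r choose m) * dilated_average \<delta> r (of_nat m / of_nat r) g y)"
proof -
  have gm: "g \<in> borel_measurable lebesgue"
    using g by (intro measurable_completion) simp
  let ?b = "\<lambda>m. (- 1) ^ (r - m + 1) * of_nat (r choose m) :: 'a"
  have sum: "(window_integral \<delta> ^^ r) (\<lambda>c. \<Sum>m=1..r. ?b m * g (y + of_nat m / of_nat r * c)) 0
      = (\<Sum>m=1..r. (window_integral \<delta> ^^ r) (\<lambda>c. ?b m * g (y + of_nat m / of_nat r * c)) 0)"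
    using \<delta> by (intro window_integral_sum[where B = "\<lambda>m. real (r choose m) * B"])
      (auto simp: norm_mult norm_power intro!: mult_left_mono bd)
  have "steklov \<delta> r g y = ((- \<delta>) powi (- int r)) *\<^sub>R
      (window_integral \<delta> ^^ r) (\<lambda>c. \<Sum>m=1..r. ?b m * g (y + of_nat m / of_nat r * c)) 0"
    by (rule steklov_eq_window_integral[OF r gm g]) simp
  then show ?thesis
    unfolding sum window_integral_mult dilated_average_def .
qed

text \<open>
  Dilation by \<open>a\<close> reduces this to \<open>window_integral_taylor\<close>; differences of step \<open>\<delta>\<close> become
  differences of step \<open>a \<delta>\<close>.
\<close>

lemma dilated_average_taylor:
  fixes g :: "real \<Rightarrow> 'a::{real_normed_field, banach, second_countable_topology}"
  assumes r: "1 \<le> r" and \<delta>: "0 < \<delta>" and a: "0 < a" and g [measurable]: "g \<in> borel_measurable borel"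
    and bd: "\<And>x. norm (g x) \<le> B"
  obtains q where "q 0 = dilated_average \<delta> r a g x"
    and "\<And>R y. \<bar>y - x\<bar> \<le> a * R \<Longrightarrow>
      norm (dilated_average \<delta> r a g y - (\<Sum>j<r. (y - x) ^ j *\<^sub>R q j))
        \<le> R ^ (r - 1) * (LINT z:{- R..R}|lborel. norm (fwd_diff r (a * \<delta>) g (x + a * z)))"
proof -
  let ?G = "\<lambda>c. g (a * c)"
  have D: "dilated_average \<delta> r a g y = (window_integral \<delta> ^^ r) ?G (y / a)" for y
    using window_integral_shift[of r \<delta> ?G "y / a" 0] a
    by (simp add: dilated_average_def distrib_left add.commute)
  have fd: "fwd_diff r \<delta> ?G (x / a + z) = fwd_diff r (a * \<delta>) g (x + a * z)" for z
    using a by (simp add: fwd_diff_def algebra_simps)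
  obtain n where n: "r = Suc n" using r by (cases r) auto
  have "?G \<in> borel_measurable borel" by measurable
  from window_integral_taylor[OF \<delta> this bd, of n "x / a"]
  obtain b where b: "b 0 = (window_integral \<delta> ^^ r) ?G (x / a)"
    "\<And>R y. \<bar>y - x / a\<bar> \<le> R \<Longrightarrow>
      norm ((window_integral \<delta> ^^ r) ?G y - (\<Sum>j\<le>n. (y - x / a) ^ j *\<^sub>R b j))
        \<le> R ^ n * (LINT z:{- R..R}|lborel. norm (fwd_diff r \<delta> ?G (x / a + z)))"
    unfolding n by blast
  show ?thesis
  proof (rule that[of "\<lambda>j. (1 / a ^ j) *\<^sub>R b j"])
    show "(1 / a ^ 0) *\<^sub>R b 0 = dilated_average \<delta> r a g x" by (simp add: b(1) D)
    fix R y assume "\<bar>y - x\<bar> \<le> a * R"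
    then have "\<bar>y / a - x / a\<bar> \<le> R"
      using a by (simp add: field_simps flip: diff_divide_distrib)
    from b(2)[OF this]
    show "norm (dilated_average \<delta> r a g y - (\<Sum>j<r. (y - x) ^ j *\<^sub>R (1 / a ^ j) *\<^sub>R b j))
        \<le> R ^ (r - 1) * (LINT z:{- R..R}|lborel. norm (fwd_diff r (a * \<delta>) g (x + a * z)))"
      unfolding D fd by (simp add: n lessThan_Suc_atMost power_divide flip: diff_divide_distrib)
  qed
qed

section \<open>Sampling operators\<close>

text \<open>
  For a kernel supported in \<open>[-T, T]\<close>, the indices that contribute to the sampling series at
  \<open>u = W t\<close>.
\<close>

definition active_nodes :: "real \<Rightarrow> real \<Rightarrow> int set"
  where "active_nodes T u = {k. \<bar>u - of_int k\<bar> \<le> T}"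

lemma active_nodes_subset: "active_nodes T u \<subseteq> {\<lceil>u - T\<rceil>..\<lfloor>u + T\<rfloor>}"
  by (auto simp: active_nodes_def abs_le_iff ceiling_le_iff le_floor_iff)

lemma finite_active_nodes [simp]: "finite (active_nodes T u)"
  by (rule finite_subset[OF active_nodes_subset]) simp

lemma card_active_nodes:
  assumes "0 \<le> T"
  shows "real (card (active_nodes T u)) \<le> 2 * T + 1"
proof -
  have "card (active_nodes T u) \<le> card {\<lceil>u - T\<rceil>..\<lfloor>u + T\<rfloor>}"
    by (intro card_mono active_nodes_subset) simp
  also have "\<dots> = nat (\<lfloor>u + T\<rfloor> - \<lceil>u - T\<rceil> + 1)" by simp
  finally have "real (card (active_nodes T u)) \<le> real (nat (\<lfloor>u + T\<rfloor> - \<lceil>u - T\<rceil> + 1))"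
    by simp
  also have "\<dots> \<le> 2 * T + 1"
    using assms of_int_floor_le[of "u + T"] le_of_int_ceiling[of "u - T"]
    by (cases "0 \<le> \<lfloor>u + T\<rfloor> - \<lceil>u - T\<rceil> + 1") (simp_all, linarith)
  finally show ?thesis .
qed

lemma time_limited_kernel_bounds:
  assumes "time_limited_kernel \<phi>"
  obtains T M where "0 < T" "0 < M" "\<And>t. T < \<bar>t\<bar> \<Longrightarrow> \<phi> t = 0" "\<And>t. norm (\<phi> t) \<le> M"
proof -
  from assms obtain T0 T1 where T01: "T0 < T1" "\<And>t. t \<notin> {T0..T1} \<Longrightarrow> \<phi> t = 0"
    and cont: "continuous_on UNIV \<phi>"
    unfolding time_limited_kernel_def by blast
  have "compact (\<phi> ` {T0..T1})"
    by (intro compact_continuous_image continuous_on_subset[OF cont]) auto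
  then obtain M where M: "0 < M" "\<forall>x\<in>\<phi> ` {T0..T1}. norm x \<le> M"
    using bounded_pos compact_imp_bounded by blast
  show ?thesis
  proof (rule that)
    show "0 < max \<bar>T0\<bar> \<bar>T1\<bar>" using T01 by linarith
    show "\<phi> t = 0" if "max \<bar>T0\<bar> \<bar>T1\<bar> < \<bar>t\<bar>" for t
      using that T01(1) by (intro T01(2)) auto
    show "norm (\<phi> t) \<le> M" for t
      using M T01(2)[of t] by (cases "t \<in> {T0..T1}") auto
  qed (rule M)
qed

lemma has_sum_active_nodes:
  fixes h :: "int \<Rightarrow> 'b::real_normed_vector"
  assumes "(h has_sum c) UNIV" "\<And>k. k \<notin> active_nodes T u \<Longrightarrow> h k = 0"
  shows "(\<Sum>k\<in>active_nodes T u. h k) = c"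
proof -
  have "(h has_sum c) (active_nodes T u)"
    using assms has_sum_cong_neutral[of UNIV "active_nodes T u" h h c] by auto
  then show ?thesis
    using has_sum_finite[OF finite_active_nodes, of h] has_sum_unique by blast
qed

lemma sampling_op_eq_sum:
  fixes \<phi> f :: "real \<Rightarrow> 'a::real_normed_field"
  assumes "\<And>t. T < \<bar>t\<bar> \<Longrightarrow> \<phi> t = 0"
  shows "sampling_op \<phi> W f t = (\<Sum>k\<in>active_nodes T (W * t). f (of_int k / W) * \<phi> (W * t - of_int k))"
proof -
  have "sampling_op \<phi> W f t
      = (\<Sum>\<^sub>\<infinity>k\<in>active_nodes T (W * t). f (of_int k / W) * \<phi> (W * t - of_int k))"
    unfolding sampling_op_def
    by (rule infsum_cong_neutral) (auto simp: active_nodes_def not_le intro!: assms)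
  then show ?thesis by simp
qed

text \<open>
  At each point the symmetric partial sums are eventually equal to the sampling series.
\<close>

lemma borel_measurable_sampling_op:
  fixes \<phi> f :: "real \<Rightarrow> 'a::{real_normed_field, second_countable_topology}"
  assumes cont: "continuous_on UNIV \<phi>" and supp: "\<And>t. T < \<bar>t\<bar> \<Longrightarrow> \<phi> t = 0"
  shows "sampling_op \<phi> W f \<in> borel_measurable borel"
proof (rule borel_measurable_LIMSEQ_metric)
  have [measurable]: "\<phi> \<in> borel_measurable borel"
    using cont by (rule borel_measurable_continuous_onI)
  let ?S = "\<lambda>n t. \<Sum>k\<in>{- int n..int n}. f (of_int k / W) * \<phi> (W * t - of_int k)"
  show "?S n \<in> borel_measurable borel" for n by measurable
  show "(\<lambda>n. ?S n t) \<longlonglongrightarrow> sampling_op \<phi> W f t" for t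
  proof (rule tendsto_eventually, rule eventually_sequentiallyI)
    fix n assume n: "nat \<lceil>\<bar>W * t\<bar> + T\<rceil> \<le> n"
    then have n': "\<bar>W * t\<bar> + T \<le> real n" by linarith
    have "active_nodes T (W * t) \<subseteq> {- int n..int n}"
    proof
      fix k assume "k \<in> active_nodes T (W * t)"
      then have "\<bar>real_of_int k\<bar> \<le> real n" using n' by (simp add: active_nodes_def)
      then show "k \<in> {- int n..int n}" by auto
    qed
    moreover have "\<phi> (W * t - of_int k) = 0" if "k \<notin> active_nodes T (W * t)" for k
      using that by (intro supp) (simp add: active_nodes_def)
    ultimately show "?S n t = sampling_op \<phi> W f t"
      using sampling_op_eq_sum[of T \<phi> W f t] supp by (auto intro!: sum.mono_neutral_right)
  qed
qed

lemma sum_powr_le: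
  fixes a :: "'i \<Rightarrow> real"
  assumes p: "0 < p" and a: "\<And>k. k \<in> K \<Longrightarrow> 0 \<le> a k" and K: "finite K"
  shows "(\<Sum>k\<in>K. a k) powr p \<le> real (card K) powr p * (\<Sum>k\<in>K. a k powr p)"
proof -
  let ?S = "\<Sum>k\<in>K. a k powr p"
  have S: "0 \<le> ?S" by (intro sum_nonneg) auto
  have "a k \<le> ?S powr (1 / p)" if "k \<in> K" for k
  proof -
    have "a k = (a k powr p) powr (1 / p)" using p a[OF that] by (simp add: powr_powr)
    also have "\<dots> \<le> ?S powr (1 / p)"
      using p that K by (intro powr_mono2 member_le_sum) auto
    finally show ?thesis .
  qed
  then have "(\<Sum>k\<in>K. a k) \<le> real (card K) * ?S powr (1 / p)"
    using sum_bounded_above[of K a "?S powr (1 / p)"] by simp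
  then have "(\<Sum>k\<in>K. a k) powr p \<le> (real (card K) * ?S powr (1 / p)) powr p"
    using p a by (intro powr_mono2 sum_nonneg) auto
  also have "\<dots> = real (card K) powr p * ?S"
    using p S by (simp add: powr_mult powr_powr)
  finally show ?thesis .
qed

text \<open>
  An enumeration of the integers gives access to the monotone convergence theorem for series.
\<close>

lemma infsum_int_eq_suminf:
  fixes h :: "int \<Rightarrow> ennreal"
  shows "(\<Sum>\<^sub>\<infinity>k. h k) = (\<Sum>n. h (int_decode n))"
proof -
  have "(\<Sum>\<^sub>\<infinity>k. h k) = (\<Sum>\<^sub>\<infinity>n. h (int_decode n))"
    using infsum_reindex_bij_betw[OF bij_int_decode, of h] by simp
  moreover have "((\<lambda>n. h (int_decode n)) has_sum (\<Sum>\<^sub>\<infinity>n. h (int_decode n))) UNIV"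
    by (intro has_sum_infsum nonneg_summable_on_complete) simp
  from sums_unique[OF has_sum_imp_sums[OF this]]
  have "(\<Sum>\<^sub>\<infinity>n. h (int_decode n)) = (\<Sum>n. h (int_decode n))" .
  ultimately show ?thesis by simp
qed

text \<open>
  At most \<open>2 T + 1\<close> summands are active at each point, so the \<open>p\<close>-th power of the series is at
  most a constant times the sum of the \<open>p\<close>-th powers over the active nodes. Node \<open>k\<close> is active on an
  interval of length \<open>2 T / W\<close>, which is \<open>2 T\<close> times its weight in the discrete norm.
\<close>

lemma Lp_norm_sampling_op_le:
  fixes \<phi> e :: "real \<Rightarrow> 'a::real_normed_field"
  assumes p: "1 \<le> p" and W: "0 < W" and T: "0 < T" and M: "0 < M"
    and supp: "\<And>t. T < \<bar>t\<bar> \<Longrightarrow> \<phi> t = 0" and bd: "\<And>t. norm (\<phi> t) \<le> M"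
  shows "Lp_norm p (sampling_op \<phi> W e)
    \<le> ennreal ((2 * T + 1) * M * (2 * T) powr (1 / p)) * lp_norm p (uniform_seq W) e"
proof -
  define C where "C = (2 * T + 1) * M"
  have C: "0 \<le> C" using T M by (simp add: C_def)
  define a where "a k = norm (e (of_int k / W)) powr p" for k
  have a0: "0 \<le> a k" for k by (simp add: a_def)
  let ?J = "\<lambda>k. {(of_int k - T) / W..(of_int k + T) / W}"
  have J: "t \<in> ?J k \<longleftrightarrow> k \<in> active_nodes T (W * t)" for t k
    using W by (auto simp: active_nodes_def abs_le_iff field_simps)
  have pt: "ennreal (norm (sampling_op \<phi> W e t) powr p)
      \<le> (\<Sum>n. ennreal (C powr p * a (int_decode n)) * indicator (?J (int_decode n)) t)" for t
  proof -
    let ?K = "active_nodes T (W * t)"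
    have "norm (sampling_op \<phi> W e t) \<le> (\<Sum>k\<in>?K. norm (e (of_int k / W)) * M)"
      using sampling_op_eq_sum[of T \<phi> W e t] supp
      by (auto simp: norm_mult intro!: sum_norm_le mult_left_mono bd)
    then have "norm (sampling_op \<phi> W e t) powr p
        \<le> ((\<Sum>k\<in>?K. norm (e (of_int k / W))) * M) powr p"
      using p by (intro powr_mono2) (auto simp: sum_distrib_right)
    also have "\<dots> = (\<Sum>k\<in>?K. norm (e (of_int k / W))) powr p * M powr p"
      by (rule powr_mult)
    also have "\<dots> \<le> (real (card ?K) powr p * (\<Sum>k\<in>?K. a k)) * M powr p"
      unfolding a_def using p by (intro mult_right_mono sum_powr_le) auto
    also have "\<dots> \<le> ((2 * T + 1) powr p * (\<Sum>k\<in>?K. a k)) * M powr p"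
      using p T card_active_nodes[of T "W * t"] a0
      by (intro mult_right_mono powr_mono2 sum_nonneg) auto
    also have "\<dots> = (\<Sum>k\<in>?K. C powr p * a k)"
      unfolding sum_distrib_left[symmetric] C_def powr_mult by (simp only: mult_ac)
    finally have "ennreal (norm (sampling_op \<phi> W e t) powr p) \<le> ennreal (\<Sum>k\<in>?K. C powr p * a k)"
      by (rule ennreal_leI)
    also have "\<dots> = (\<Sum>k\<in>?K. ennreal (C powr p * a k))"
      using a0 by (intro sum_ennreal[symmetric]) auto
    also have "\<dots> = (\<Sum>\<^sub>\<infinity>k\<in>?K. ennreal (C powr p * a k))"
      by simp
    also have "\<dots> = (\<Sum>\<^sub>\<infinity>k. ennreal (C powr p * a k) * indicator (?J k) t)"
    proof -
      have "indicator (?J k) t = (if k \<in> ?K then 1 else 0 :: ennreal)" for k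
        by (simp only: indicator_def J of_bool_def)
      then show ?thesis by (intro infsum_cong_neutral) auto
    qed
    finally show ?thesis by (simp only: infsum_int_eq_suminf)
  qed
  have "(\<integral>\<^sup>+ t. ennreal (norm (sampling_op \<phi> W e t) powr p) \<partial>lebesgue)
      \<le> (\<integral>\<^sup>+ t. (\<Sum>n. ennreal (C powr p * a (int_decode n)) * indicator (?J (int_decode n)) t) \<partial>lborel)"
    unfolding nn_integral_completion by (intro nn_integral_mono pt)
  also have "\<dots> = (\<Sum>n. \<integral>\<^sup>+ t. ennreal (C powr p * a (int_decode n)) * indicator (?J (int_decode n)) t \<partial>lborel)"
    by (rule nn_integral_suminf) measurable
  also have "\<dots> = (\<Sum>n. ennreal (C powr p * (2 * T)) * ennreal (a (int_decode n) * (1 / W)))"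
  proof (intro suminf_cong)
    fix n
    let ?k = "int_decode n"
    have "(\<integral>\<^sup>+ t. ennreal (C powr p * a ?k) * indicator (?J ?k) t \<partial>lborel)
        = ennreal (C powr p * a ?k) * ennreal (2 * T / W)"
      using T W by (subst nn_integral_cmult_indicator)
        (auto simp: emeasure_lborel_Icc_eq field_simps)
    also have "\<dots> = ennreal (C powr p * (2 * T)) * ennreal (a ?k * (1 / W))"
      using T W a0 by (simp add: mult_ac flip: ennreal_mult)
    finally show "(\<integral>\<^sup>+ t. ennreal (C powr p * a ?k) * indicator (?J ?k) t \<partial>lborel)
        = ennreal (C powr p * (2 * T)) * ennreal (a ?k * (1 / W))" .
  qed
  also have "\<dots> = ennreal (C powr p * (2 * T)) * (\<Sum>\<^sub>\<infinity>k. ennreal (a k * (1 / W)))"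
    by (simp only: ennreal_suminf_cmult infsum_int_eq_suminf)
  also have "C powr p * (2 * T) = (C * (2 * T) powr (1 / p)) powr p"
    using p T C by (simp add: powr_mult powr_powr)
  also have "(\<Sum>\<^sub>\<infinity>k. ennreal (a k * (1 / W)))
      = (\<Sum>\<^sub>\<infinity>j. ennreal (norm (e (uniform_seq W j)) powr p * (uniform_seq W j - uniform_seq W (j - 1))))"
    by (intro infsum_cong) (simp add: a_def uniform_seq_def flip: diff_divide_distrib)
  finally have "Lp_norm p (sampling_op \<phi> W e) \<le> ennroot p (ennreal ((C * (2 * T) powr (1 / p)) powr p) *
      (\<Sum>\<^sub>\<infinity>j. ennreal (norm (e (uniform_seq W j)) powr p * (uniform_seq W j - uniform_seq W (j - 1)))))"
    unfolding Lp_norm_def using p by (intro ennroot_mono) auto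
  also have "\<dots> = ennreal (C * (2 * T) powr (1 / p)) * lp_norm p (uniform_seq W) e"
    unfolding lp_norm_def using p C by (intro ennroot_cmult) auto
  finally show ?thesis by (simp add: C_def)
qed

section \<open>The sampling error of Steklov averages\<close>

text \<open>
  The moment conditions, rescaled from \<open>k - W x\<close> to \<open>k / W - x\<close>, show that \<open>S\<close> maps the polynomial
  to a function whose value at \<open>x\<close> is \<open>q 0 = u x\<close>. Hence the error at \<open>x\<close> is a sum over the active
  nodes of deviations of \<open>u\<close> from the polynomial.
\<close>

lemma sampling_op_error_le_of_polynomial_approx:
  fixes \<phi> u :: "real \<Rightarrow> 'a::real_normed_field"
  assumes kernel: "time_limited_kernel \<phi>"
    and moments: "\<And>j u. j \<in> {1..r - 1} \<Longrightarrow>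
      ((\<lambda>k::int. ((of_int k - u) ^ j) *\<^sub>R \<phi> (u - of_int k)) has_sum 0) UNIV"
    and r: "1 \<le> r" and W: "0 < W" and T: "0 < T"
    and supp: "\<And>t. T < \<bar>t\<bar> \<Longrightarrow> \<phi> t = 0" and bd: "\<And>t. norm (\<phi> t) \<le> M"
    and q0: "q 0 = u x"
    and approx: "\<And>y. \<bar>y - x\<bar> \<le> T / W \<Longrightarrow> norm (u y - (\<Sum>j<r. (y - x) ^ j *\<^sub>R q j)) \<le> E"
  shows "norm (u x - sampling_op \<phi> W u x) \<le> (2 * T + 1) * M * E"
proof -
  let ?K = "active_nodes T (W * x)"
  let ?w = "\<lambda>k. \<phi> (W * x - of_int k)"
  let ?P = "\<lambda>y. \<Sum>j<r. (y - x) ^ j *\<^sub>R q j"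
  have out: "?w k = 0" if "k \<notin> ?K" for k
    using that by (intro supp) (auto simp: active_nodes_def)
  have mom: "(\<Sum>k\<in>?K. ((of_int k / W - x) ^ j) *\<^sub>R ?w k) = (if j = 0 then 1 else 0)" if "j < r" for j
  proof (cases "j = 0")
    case True
    have "((\<lambda>k::int. ?w k) has_sum 1) UNIV"
      using kernel by (simp add: time_limited_kernel_def)
    from has_sum_active_nodes[OF this out] show ?thesis using True by simp
  next
    case False
    then have "j \<in> {1..r - 1}" using that by auto
    from has_sum_active_nodes[OF moments[OF this, of "W * x"], of T "W * x"] out
    have 0: "(\<Sum>k\<in>?K. ((of_int k - W * x) ^ j) *\<^sub>R ?w k) = 0" by simp
    have "(of_int k / W - x) ^ j = (1 / W) ^ j * (of_int k - W * x) ^ j" for k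
      using W by (simp add: field_simps flip: power_mult_distrib)
    then have "(\<Sum>k\<in>?K. ((of_int k / W - x) ^ j) *\<^sub>R ?w k)
        = (1 / W) ^ j *\<^sub>R (\<Sum>k\<in>?K. ((of_int k - W * x) ^ j) *\<^sub>R ?w k)"
      by (simp add: scaleR_sum_right)
    with 0 False show ?thesis by simp
  qed
  have "(\<Sum>k\<in>?K. ?P (of_int k / W) * ?w k)
      = (\<Sum>j<r. q j * (\<Sum>k\<in>?K. ((of_int k / W - x) ^ j) *\<^sub>R ?w k))"
    unfolding sum_distrib_right sum_distrib_left
    by (subst sum.swap) (simp add: mult_ac)
  also have "\<dots> = (\<Sum>j<r. if j = 0 then q j else 0)"
    by (intro sum.cong refl) (simp add: mom)
  also have "\<dots> = u x" using r q0 by simp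
  finally have "sampling_op \<phi> W u x - u x = (\<Sum>k\<in>?K. (u (of_int k / W) - ?P (of_int k / W)) * ?w k)"
    by (simp add: sampling_op_eq_sum[of T \<phi>, OF supp] left_diff_distrib sum_subtractf)
  then have "norm (u x - sampling_op \<phi> W u x) \<le> (\<Sum>k\<in>?K. E * M)"
  proof (subst norm_minus_commute, simp only:, intro sum_norm_le)
    fix k assume "k \<in> ?K"
    then have "\<bar>of_int k / W - x\<bar> \<le> T / W"
      using W by (auto simp: active_nodes_def abs_le_iff field_simps)
    from approx[OF this] bd
    show "norm ((u (of_int k / W) - ?P (of_int k / W)) * ?w k) \<le> E * M"
      unfolding norm_mult by (intro mult_mono) (auto intro: order_trans[OF norm_ge_zero])
  qed
  also have "\<dots> \<le> (2 * T + 1) * (E * M)"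
  proof -
    have "0 \<le> E" using approx[of x] W T by (auto intro: order_trans[OF norm_ge_zero])
    moreover have "0 \<le> M" using bd order_trans[OF norm_ge_zero] by blast
    ultimately show ?thesis
      using card_active_nodes[of T "W * x"] T by (simp add: mult_right_mono)
  qed
  finally show ?thesis by (simp add: mult_ac)
qed

lemma sampling_op_scaled_sum:
  fixes \<phi> :: "real \<Rightarrow> 'a::real_normed_field"
  assumes "\<And>t. T < \<bar>t\<bar> \<Longrightarrow> \<phi> t = 0"
  shows "sampling_op \<phi> W (\<lambda>y. c *\<^sub>R (\<Sum>i\<in>I. b i * f i y)) t
    = c *\<^sub>R (\<Sum>i\<in>I. b i * sampling_op \<phi> W (f i) t)"
proof -
  note S = sampling_op_eq_sum[of T \<phi>, where W = W and t = t]
  have "sampling_op \<phi> W (\<lambda>y. c *\<^sub>R (\<Sum>i\<in>I. b i * f i y)) t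
      = c *\<^sub>R (\<Sum>k\<in>active_nodes T (W * t). \<Sum>i\<in>I. b i * f i (of_int k / W) * \<phi> (W * t - of_int k))"
    using S assms by (simp add: scaleR_sum_right sum_distrib_right)
  also have "\<dots> = c *\<^sub>R (\<Sum>i\<in>I. b i * sampling_op \<phi> W (f i) t)"
    using S assms by (subst sum.swap) (simp add: sum_distrib_left mult.assoc)
  finally show ?thesis .
qed

lemma sampling_op_diff:
  fixes \<phi> f g :: "real \<Rightarrow> 'a::real_normed_field"
  assumes "\<And>t. T < \<bar>t\<bar> \<Longrightarrow> \<phi> t = 0"
  shows "sampling_op \<phi> W (\<lambda>y. f y - g y) t = sampling_op \<phi> W f t - sampling_op \<phi> W g t"
  using sampling_op_eq_sum[of T \<phi>, where W = W and t = t] assms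
  by (simp add: left_diff_distrib sum_subtractf)

text \<open>
  Pointwise, the error is at most a combination of the integrals \<open>D m x\<close> of the differences of order
  \<open>r\<close> and step \<open>m \<delta> / r \<le> \<delta>\<close> over a window around \<open>x\<close>. The powers of \<open>\<delta>\<close> cancel: \<open>\<delta>\<^sup>-\<^sup>r\<close> from
  the Steklov average, \<open>\<delta>\<^sup>r\<^sup>-\<^sup>1\<close> from the Taylor remainder, and \<open>\<delta>\<close> from the length of the
  window.
\<close>

lemma Lp_norm_steklov_sampling_error_le:
  fixes \<phi> g :: "real \<Rightarrow> 'a::{real_normed_field, banach, second_countable_topology}"
  assumes kernel: "time_limited_kernel \<phi>"
    and moments: "\<And>j u. j \<in> {1..r - 1} \<Longrightarrow>
      ((\<lambda>k::int. ((of_int k - u) ^ j) *\<^sub>R \<phi> (u - of_int k)) has_sum 0) UNIV"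
    and s: "1 \<le> s" "s \<le> r" and p: "1 \<le> p" and W: "0 < W" and T: "0 < T" and M: "0 < M"
    and supp: "\<And>t. T < \<bar>t\<bar> \<Longrightarrow> \<phi> t = 0" and bd: "\<And>t. norm (\<phi> t) \<le> M"
    and g [measurable]: "g \<in> borel_measurable borel" and gB: "\<And>x. norm (g x) \<le> B"
  shows "Lp_norm p (\<lambda>x. steklov (1 / W) r g x - sampling_op \<phi> W (steklov (1 / W) r g) x)
    \<le> ennreal ((\<Sum>m=1..r. real (r choose m)) * ((2 * T + 1) * M * (2 * (real r * T) ^ r)))
        * (2 ^ (r - s) * smoothness_modulus s g (1 / W) p)" (is "_ \<le> _ * ?\<omega>")
proof -
  have r: "1 \<le> r" using s by simp
  have gm: "g \<in> borel_measurable lebesgue"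
    using g by (intro measurable_completion) simp
  define \<delta> where "\<delta> = 1 / W"
  \<comment> \<open>one radius that serves all \<open>m\<close>: in the coordinate dilated by \<open>a m \<ge> 1 / r\<close>, the active nodes lie within distance \<open>R\<close>\<close>
  define R where "R = real r * T * \<delta>"
  define a where "a m = real m / real r" for m
  define u where "u m = dilated_average \<delta> r (a m) g" for m
  define D where "D m x = (LINT z:{- R..R}|lborel. norm (fwd_diff r (a m * \<delta>) g (x + a m * z)))" for m x
  define K where "K m = W ^ r * real (r choose m) * ((2 * T + 1) * M * R ^ (r - 1))" for m
  define b :: "nat \<Rightarrow> 'a" where "b m = (- 1) ^ (r - m + 1) * of_nat (r choose m)" for m
  let ?\<kappa> = "(- \<delta>) powi (- int r)"
  have \<delta>: "0 < \<delta>" using W by (simp add: \<delta>_def)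
  have R: "0 < R" using r T \<delta> by (simp add: R_def)
  have K: "0 \<le> K m" for m using W T M R by (simp add: K_def)
  have D0: "0 \<le> D m x" for m x
    unfolding D_def set_lebesgue_integral_def by (auto intro!: integral_nonneg_AE)
  have a: "0 < a m" "a m \<le> 1" "T / W \<le> a m * R" if "m \<in> {1..r}" for m
    using that r T W by (auto simp: a_def R_def \<delta>_def field_simps)
  have piece: "norm (u m x - sampling_op \<phi> W (u m) x) \<le> (2 * T + 1) * M * (R ^ (r - 1) * D m x)"
    if m: "m \<in> {1..r}" for m x
  proof -
    obtain q where q: "q 0 = u m x"
      "\<And>R y. \<bar>y - x\<bar> \<le> a m * R \<Longrightarrow> norm (u m y - (\<Sum>j<r. (y - x) ^ j *\<^sub>R q j))
        \<le> R ^ (r - 1) * (LINT z:{- R..R}|lborel. norm (fwd_diff r (a m * \<delta>) g (x + a m * z)))"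
      using dilated_average_taylor[OF r \<delta> a(1)[OF m] g gB, of x] unfolding u_def by blast
    show ?thesis
    proof (rule sampling_op_error_le_of_polynomial_approx[where q = q and u = "u m" and r = r,
          OF kernel moments r W T supp bd q(1)])
      fix y assume "\<bar>y - x\<bar> \<le> T / W"
      then have "\<bar>y - x\<bar> \<le> a m * R" using a(3)[OF m] by simp
      from q(2)[OF this]
      show "norm (u m y - (\<Sum>j<r. (y - x) ^ j *\<^sub>R q j)) \<le> R ^ (r - 1) * D m x"
        by (simp add: D_def)
    qed
  qed
  have "norm (steklov \<delta> r g x - sampling_op \<phi> W (steklov \<delta> r g) x) \<le> (\<Sum>m=1..r. K m * D m x)" for x
  proof -
    have st: "steklov \<delta> r g = (\<lambda>y. ?\<kappa> *\<^sub>R (\<Sum>m=1..r. b m * u m y))"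
      unfolding u_def a_def b_def by (intro ext steklov_eq_dilated_averages[OF r \<delta> g gB])
    have "sampling_op \<phi> W (steklov \<delta> r g) x = ?\<kappa> *\<^sub>R (\<Sum>m=1..r. b m * sampling_op \<phi> W (u m) x)"
      unfolding st by (rule sampling_op_scaled_sum) (rule supp)
    then have "steklov \<delta> r g x - sampling_op \<phi> W (steklov \<delta> r g) x
        = ?\<kappa> *\<^sub>R (\<Sum>m=1..r. b m * (u m x - sampling_op \<phi> W (u m) x))"
      by (simp only: st right_diff_distrib sum_subtractf scaleR_diff_right)
    also have "norm \<dots> \<le> W ^ r * (\<Sum>m=1..r. real (r choose m) * ((2 * T + 1) * M * (R ^ (r - 1) * D m x)))"
    proof -
      have "\<bar>?\<kappa>\<bar> = W ^ r"
        using W by (simp add: \<delta>_def power_int_minus power_abs power_one_over)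
      moreover have "norm (\<Sum>m=1..r. b m * (u m x - sampling_op \<phi> W (u m) x))
          \<le> (\<Sum>m=1..r. real (r choose m) * ((2 * T + 1) * M * (R ^ (r - 1) * D m x)))"
      proof (rule sum_norm_le)
        fix m assume "m \<in> {1..r}"
        from piece[OF this, of x]
        show "norm (b m * (u m x - sampling_op \<phi> W (u m) x))
            \<le> real (r choose m) * ((2 * T + 1) * M * (R ^ (r - 1) * D m x))"
          by (simp add: b_def norm_mult norm_power mult_left_mono)
      qed
      ultimately show ?thesis
        using W by (simp add: mult_left_mono)
    qed
    finally show ?thesis
      by (simp add: K_def sum_distrib_left mult_ac)
  qed
  then have le: "Lp_norm p (\<lambda>x. steklov \<delta> r g x - sampling_op \<phi> W (steklov \<delta> r g) x)
      \<le> Lp_norm p (\<lambda>x. \<Sum>m=1..r. K m * D m x)"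
    using p K D0 by (intro Lp_norm_mono_AE) (auto simp: sum_nonneg intro!: order_trans[OF _ abs_ge_self])
  have Dm: "D m \<in> borel_measurable lebesgue" for m
  proof -
    have "D m \<in> borel_measurable borel"
      unfolding D_def[abs_def] set_lebesgue_integral_def fwd_diff_def by measurable
    then show ?thesis by (intro measurable_completion) simp
  qed
  note le
  also have "Lp_norm p (\<lambda>x. \<Sum>m=1..r. K m * D m x) \<le> (\<Sum>m=1..r. Lp_norm p (\<lambda>x. K m * D m x))"
  proof (rule Lp_norm_sum[OF p])
    show "(\<lambda>x. K m * D m x) \<in> borel_measurable lebesgue" for m
      by (rule borel_measurable_times[OF borel_measurable_const Dm])
  qed simp
  also have "\<dots> \<le> (\<Sum>m=1..r. ennreal (real (r choose m) * ((2 * T + 1) * M * (2 * (real r * T) ^ r))) * ?\<omega>)"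
  proof (rule sum_mono)
    fix m assume m: "m \<in> {1..r}"
    have "Lp_norm p (D m) \<le> ennreal (R - - R) * ?\<omega>"
      unfolding D_def[abs_def]
    proof (rule Lp_norm_integral_le[OF p])
      show "(\<lambda>(x, z). norm (fwd_diff r (a m * \<delta>) g (x + a m * z))) \<in> borel_measurable (borel \<Otimes>\<^sub>M borel)"
        unfolding fwd_diff_def by measurable
      show "norm (norm (fwd_diff r (a m * \<delta>) g (x + a m * z))) \<le> (\<Sum>k=0..r. real (r choose k) * B)" for x z
        using fwd_diff_bound[of g, OF gB] by simp
      fix z
      have "Lp_norm p (\<lambda>x. norm (fwd_diff r (a m * \<delta>) g (x + a m * z)))
          = Lp_norm p (\<lambda>x. fwd_diff r (a m * \<delta>) g (x + a m * z))"
        by (simp add: Lp_norm_def)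
      also have "\<dots> = Lp_norm p (fwd_diff r (a m * \<delta>) g)"
        by (rule Lp_norm_translate[OF borel_measurable_fwd_diff_lebesgue[OF gm]])
      also have "\<dots> \<le> ?\<omega>"
        unfolding \<delta>_def[symmetric] using a[OF m] \<delta>
        by (intro Lp_norm_fwd_diff_le_modulus[OF p gm s]) (auto simp: mult_le_cancel_right1)
      finally show "Lp_norm p (\<lambda>x. norm (fwd_diff r (a m * \<delta>) g (x + a m * z))) \<le> ?\<omega>" .
    qed (use R in auto)
    then have "ennreal (K m) * Lp_norm p (D m) \<le> ennreal (K m) * (ennreal (R - - R) * ?\<omega>)"
      by (rule mult_left_mono) simp
    also have "\<dots> = ennreal (K m * (R - - R)) * ?\<omega>"
      by (simp only: ennreal_mult'[OF K] mult.assoc)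
    finally have le1: "ennreal (K m) * Lp_norm p (D m) \<le> ennreal (K m * (R - - R)) * ?\<omega>" .
    have le2: "Lp_norm p (\<lambda>x. K m * D m x) \<le> ennreal (K m) * Lp_norm p (D m)"
      using p K by (intro Lp_norm_bound_cmult Dm) (auto simp: abs_mult)
    have eq: "K m * (R - - R) = real (r choose m) * ((2 * T + 1) * M * (2 * (real r * T) ^ r))"
    proof -
      have "W ^ r * (R ^ (r - 1) * R) = (real r * T) ^ r"
        using r W by (simp add: R_def \<delta>_def power_divide flip: power_Suc2)
      then have "K m * (R - - R) = real (r choose m) * ((2 * T + 1) * M * (2 * (W ^ r * (R ^ (r - 1) * R))))"
        by (simp add: K_def)
      also note \<open>W ^ r * (R ^ (r - 1) * R) = (real r * T) ^ r\<close>
      finally show ?thesis .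
    qed
    show "Lp_norm p (\<lambda>x. K m * D m x)
        \<le> ennreal (real (r choose m) * ((2 * T + 1) * M * (2 * (real r * T) ^ r))) * ?\<omega>"
      using order_trans[OF le2 le1] unfolding eq .
  qed
  also have "\<dots> = ennreal ((\<Sum>m=1..r. real (r choose m)) * ((2 * T + 1) * M * (2 * (real r * T) ^ r))) * ?\<omega>"
    using T M by (simp add: sum_distrib_right flip: sum_ennreal)
  finally show ?thesis by (simp add: \<delta>_def)
qed

section \<open>The approximation theorem\<close>

theorem theorem6p11:
  fixes \<phi> :: "real \<Rightarrow> 'a::{real_normed_field, banach, second_countable_topology}"
    and r s :: nat and p :: real
  assumes kernel: "time_limited_kernel \<phi>"
    and r: "1 \<le> r"
    and moments: "\<And>j u. j \<in> {1..r - 1} \<Longrightarrow>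
          ((\<lambda>k::int. ((of_int k - u) ^ j) *\<^sub>R \<phi> (u - of_int k)) has_sum 0) UNIV"
    and s: "1 \<le> s" "s \<le> r"
    and p: "1 \<le> p"
  shows "\<exists>K1 C1 :: real. 0 < K1 \<and> 0 < C1 \<and>
    (\<forall>f \<in> Lambda_space p. \<forall>W > 0.
       Lp_norm p (\<lambda>t. f t - sampling_op \<phi> W f t)
         \<le> ennreal K1 * lp_norm p (uniform_seq W) (\<lambda>t. steklov (1 / W) r f t - f t)
           + ennreal C1 * smoothness_modulus s f (1 / W) p \<and>
       Lp_norm p (\<lambda>t. f t - sampling_op \<phi> W f t)
         \<le> ennreal (max K1 C1) * semidiscrete_modulus r s f (1 / W) (uniform_seq W) p)"
proof -
  obtain T M where TM: "0 < T" "0 < M"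
    and supp: "\<And>t. T < \<bar>t\<bar> \<Longrightarrow> \<phi> t = 0" and bd: "\<And>t. norm (\<phi> t) \<le> M"
    by (rule time_limited_kernel_bounds[OF kernel]) (rule that, assumption+)
  define K1 where "K1 = (2 * T + 1) * M * (2 * T) powr (1 / p)"
  define C where "C = (\<Sum>m=1..r. real (r choose m)) * ((2 * T + 1) * M * (2 * (real r * T) ^ r))"
  define C1 where "C1 = (1 + C) * 2 ^ (r - s)"
  have pos: "0 < K1" "0 \<le> C" "0 < C1"
  proof -
    show "0 < K1" using TM by (simp add: K1_def)
    show C: "0 \<le> C"
      unfolding C_def using TM by (intro mult_nonneg_nonneg sum_nonneg) simp_all
    show "0 < C1" using C by (simp add: C1_def)
  qed
  have bounds: "Lp_norm p (\<lambda>t. f t - sampling_op \<phi> W f t) \<le> ennreal K1 * A + ennreal C1 * \<omega> \<and>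
      Lp_norm p (\<lambda>t. f t - sampling_op \<phi> W f t) \<le> ennreal (max K1 C1) * (A + \<omega>)"
    if f: "f \<in> Lambda_space p" and W: "0 < W"
      and A: "A = lp_norm p (uniform_seq W) (\<lambda>t. steklov (1 / W) r f t - f t)"
      and \<omega>: "\<omega> = smoothness_modulus s f (1 / W) p" for f W A \<omega>
  proof -
    let ?S = "sampling_op \<phi> W" and ?st = "steklov (1 / W) r"
    have fm: "f \<in> borel_measurable lebesgue" using f by (simp add: Lambda_space_def)
    obtain B where B: "\<And>x. norm (f x) \<le> B"
      using f unfolding Lambda_space_def bounded_iff by fast
    obtain g where g: "g \<in> borel_measurable borel" and gB: "\<And>x. norm (g x) \<le> B"
      and fg: "AE x in lebesgue. f x = g x"
      by (rule ex_bounded_borel_version[OF fm B]) (rule that, assumption+)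
    have gm: "g \<in> borel_measurable lebesgue"
      using g by (intro measurable_completion) simp
    have st: "?st f = ?st g"
    proof
      fix x
      have "AE x in lebesgue. g x = g x" by simp
      from steklov_eq_window_integral[OF r fm g fg] steklov_eq_window_integral[OF r gm g this]
      show "?st f x = ?st g x" by simp
    qed
    have \<omega>g: "\<omega> = smoothness_modulus s g (1 / W) p"
      unfolding \<omega> by (rule smoothness_modulus_cong_AE[OF fg])
    have Sm: "?S h \<in> borel_measurable lebesgue" for h
      using borel_measurable_sampling_op[of \<phi> T W h] kernel supp
      by (intro measurable_completion) (simp add: time_limited_kernel_def)
    have stm: "?st g \<in> borel_measurable lebesgue"
      using borel_measurable_steklov[OF r g] by (intro measurable_completion) simp
    have m1: "(\<lambda>t. f t - ?st g t) \<in> borel_measurable lebesgue"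
      by (rule borel_measurable_diff[OF fm stm])
    have m2: "(\<lambda>t. ?st g t - ?S (?st g) t) \<in> borel_measurable lebesgue"
      by (rule borel_measurable_diff[OF stm Sm])
    \<comment> \<open>the last summand keeps \<open>f\<close>, whose values at the nodes must not be changed to those of \<open>g\<close>\<close>
    have split: "f t - ?S f t = (f t - ?st g t) + ((?st g t - ?S (?st g) t) + ?S (\<lambda>t. ?st g t - f t) t)" for t
      using sampling_op_diff[of T \<phi> W "?st g" f t] supp by simp
    have "Lp_norm p (\<lambda>t. f t - ?S f t) \<le> Lp_norm p (\<lambda>t. f t - ?st g t)
        + Lp_norm p (\<lambda>t. (?st g t - ?S (?st g) t) + ?S (\<lambda>t. ?st g t - f t) t)"
      unfolding split by (rule Lp_norm_triangle[OF p m1 borel_measurable_add[OF m2 Sm]])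
    also have "\<dots> \<le> Lp_norm p (\<lambda>t. f t - ?st g t) + (Lp_norm p (\<lambda>t. ?st g t - ?S (?st g) t)
        + Lp_norm p (?S (\<lambda>t. ?st g t - f t)))"
      by (rule add_left_mono[OF Lp_norm_triangle[OF p m2 Sm]])
    also have "\<dots> \<le> 2 ^ (r - s) * \<omega> + (ennreal C * (2 ^ (r - s) * \<omega>) + ennreal K1 * A)"
    proof (intro add_mono)
      have "Lp_norm p (\<lambda>t. f t - ?st g t) = Lp_norm p (\<lambda>t. g t - ?st g t)"
        using fg by (intro Lp_norm_cong_AE) (auto elim!: eventually_mono)
      also have "\<dots> = Lp_norm p (\<lambda>t. ?st g t - g t)"
        by (simp add: Lp_norm_def norm_minus_commute)
      also have "\<dots> \<le> 2 ^ (r - s) * \<omega>"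
        unfolding \<omega>g using W by (intro Lp_norm_steklov_minus_le[OF p s _ g gB]) simp
      finally show "Lp_norm p (\<lambda>t. f t - ?st g t) \<le> 2 ^ (r - s) * \<omega>" .
      show "Lp_norm p (\<lambda>t. ?st g t - ?S (?st g) t) \<le> ennreal C * (2 ^ (r - s) * \<omega>)"
        unfolding \<omega>g C_def
        by (rule Lp_norm_steklov_sampling_error_le[OF kernel moments s p W TM supp bd g gB])
      show "Lp_norm p (?S (\<lambda>t. ?st g t - f t)) \<le> ennreal K1 * A"
        unfolding A st K1_def by (rule Lp_norm_sampling_op_le[OF p W TM supp bd])
    qed
    also have "\<dots> = ennreal K1 * A + ennreal C1 * \<omega>"
    proof -
      have "ennreal C1 = (1 + ennreal C) * 2 ^ (r - s)"
        using pos by (simp add: C1_def ennreal_mult' flip: ennreal_power ennreal_numeral ennreal_plus ennreal_1)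
      then show ?thesis by (simp add: algebra_simps)
    qed
    finally have main: "Lp_norm p (\<lambda>t. f t - ?S f t) \<le> ennreal K1 * A + ennreal C1 * \<omega>" .
    also have "\<dots> \<le> ennreal (max K1 C1) * A + ennreal (max K1 C1) * \<omega>"
      by (intro add_mono mult_right_mono ennreal_leI) auto
    finally show ?thesis using main by (simp add: distrib_left)
  qed
  show ?thesis
    unfolding semidiscrete_modulus_def
    by (intro exI[of _ K1] exI[of _ C1] conjI pos ballI allI impI bounds) auto
qed

end
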